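(* Let $X=G/K$ be an irreducible homogeneous space of a Lie group $G$ with $K$ compact. Then any covariance matrix function $A(t)$ on $X$ is given by $A(t)=a(t)I$ for some nondecreasing continuous function $a(t)$ with $a(0)=0$, where $I$ is the identity matrix. Moreover, if the coordinate functions $\phi_i$ are chosen so that $\sum_{i=1}^n\phi_i(x)\xi_i\in V$ for all $x\in X$ (with $V$ as described in the context), then the extended drift $b_t$ of an inhomogeneous Lévy process $x_t$ in $X$ with $x_0=o$ is trivial, that is, $b_t=o$ for all $t\ge0$, where $b_t$ is the extended drift in the extended Lévy triple $(b,A,\eta)$ on $X$ representing the process.
   Context: Rcll means right continuous with left limits; $\mathcal F^x_t=\sigma\{x_u:0\le u\le t\}$. $K$ is a closed subgroup of $G$, and $G$ acts on $X=G/K$ by $g(g'K)=gg'K$; $\pi:G\to X$ is the projection, $o=eK$. An inhomogeneous Lévy process in $X$ is a rcll inhomogeneous Markov process whose transition function is $G$-invariant: $P_{s,t}(f\circ g)=(P_{s,t}f)\circ g$ for $g\in G$, $s<t$ and nonnegative Borel $f$. $\mathfrak g,\mathfrak k$ are the Lie algebras of $G,K$; $\mathfrak p$ is an $\mathrm{Ad}(K)$-invariant subspace of $\mathfrak g$ complementary to $\mathfrak k$. $X$ is irreducible if the induced linear action of $K$ on $T_oX$ (equivalently the $\mathrm{Ad}(K)$-action on $\mathfrak p$) has no nontrivial invariant subspace. $\xi_1,\dots,\xi_n$ is a chosen basis of $\mathfrak p$. $V$ is a convex neighborhood of $0$ in $\mathfrak p$ mapped by $\pi\circ\exp$ diffeomorphically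 onto a neighborhood $U$ of $o$ in $X$. A point $b\in X$ is $K$-invariant if $kb=b$ for all $k\in K$; a measure $\mu$ on $X$ is $K$-invariant if $k\mu=\mu$ for all $k\in K$. Coordinate functions are $\phi_1,\dots,\phi_n\in C_c^\infty(X)$ with $x=\exp(\sum_i\phi_i(x)\xi_i)o$ near $o$ and $\sum_i\phi_i(x)\mathrm{Ad}(k)\xi_i=\sum_i\phi_i(kx)\xi_i$ for all $k\in K$, $x\in X$. A covariance matrix function on $X$ is an $n\times n$ symmetric matrix valued function $A(t)$, $t\ge0$, with continuous entries, $A(0)=0$, $A(t)-A(s)$ nonnegative definite for $s<t$, and $A(t)$ $\mathrm{Ad}(K)$-invariant: $A_{ij}(t)=\sum_{p,q}A_{pq}(t)[\mathrm{Ad}(k)]_{ip}[\mathrm{Ad}(k)]_{jq}$ for $k\in K$, where $\mathrm{Ad}(k)\xi_j=\sum_i[\mathrm{Ad}(k)]_{ij}\xi_i$. Product notation: a section map is a Borel map $S:X\to G$ with $\pi\circ S=\mathrm{id}_X$; products are $x_1\cdots x_m=S(x_1)\cdots S(x_{m-1})x_m$, $x^{-1}y=S(x)^{-1}y$, and $b^{-1}=S(b)^{-1}o$ for $K$-invariant $b$. For $\xi,\zeta\in\mathfrak g$: $\xi f(x)=\frac{d}{dt}f(S(x)e^{t\xi}o)|_{t=0}$, $\xi\zeta f(x)=\frac{\partial^2}{\partial t\partial s}f(S(x)e^{t\xi}e^{s\zeta}o)|_{t=s=0}$; $\mathrm{Ad}(b)=\mathrm{Ad}(S(b))$. The sums and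 integrals in the martingale expression below do not depend on the choice of $S$. A measure function on $X$ is a family of $\sigma$-finite measures $\eta(t,\cdot)$, $t\ge0$, nondecreasing and (setwise) right continuous in $t$, identified with the measure $\eta(dt,dx)$ on $\mathbb R_+\times X$ with $\eta([0,t]\times B)=\eta(t,B)$; its continuous part is $\eta^c(t,\cdot)=\int_{[0,t]\cap J^c}\eta(ds,\cdot)$, $J=\{t>0:\eta(\{t\}\times X)>0\}$. It is an extended Lévy measure function if each $\eta(t,\cdot)$ is $K$-invariant, $\eta(0,\cdot)=0$, $\eta(t,\{o\})=0$, $\eta(t,W^c)<\infty$ for every neighborhood $W$ of $o$, $\int\sum_i\phi_i^2\,d\eta^c(t,\cdot)<\infty$, $\eta(\{t\}\times X)\le1$, and $\sum_{s\le t}\int\sum_i(\phi_i-\phi_i(h_s))^2d\nu_s<\infty$, for all $t\geq 0$, where $\nu_t=\eta(\{t\}\times\cdot)+[1-\eta(\{t\}\times X)]\delta_o$, $\nu_t(\phi_i)=\int\phi_i\,d\nu_t$ and $h_t=\exp(\sum_i\nu_t(\phi_i)\xi_i)o$. An extended drift is a rcll path $b_t$ of $K$-invariant points of $X$ with $b_0=o$. An extended Lévy triple $(b,A,\eta)$ consists of an extended drift, a covariance matrix function and an extended Lévy measure function with $b_{t-}^{-1}b_t=h_t$ for all $t>0$. It represents $x_t$ if, with $z_t=x_tb_t^{-1}$ (so $x_t=z_tb_t$), for all $f\in C_c^\infty(X)$ $$\begin{aligned}&f(z_t)-\tfrac12\int_0^t\sum_{j,k}[\mathrm{Ad}(b_s)\xi_j][\mathrm{Ad}(b_s)\xi_k]f(z_s)\,dA_{jk}(s)\\&-\int_0^t\int_X\Big\{f(z_sb_sxb_s^{-1})-f(z_s)-\sum_j\phi_j(x)[\mathrm{Ad}(b_s)\xi_j]f(z_s)\Big\}\eta^c(ds,dx)\\&-\sum_{u\le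 t}\int_X[f(z_{u-}b_{u-}xh_u^{-1}b_{u-}^{-1})-f(z_{u-})]\nu_u(dx)\end{aligned}$$ is a martingale under $\mathcal F^x_t$. Every inhomogeneous Lévy process in $X$ with $x_0=o$ is represented by a unique extended Lévy triple.
   Formalization: For A(t)=a(t)I the basis ξ_1,…,ξ_n is assumed orthonormal for some Ad(K)-invariant inner product on p (false for a general basis); for b_t=o, if dim X=1, Ad(K) is assumed nontrivial on p (else G=X=R, x_t=t is a counterexample). *)

theory Defs
  imports "HOL-Probability.Probability" "HOL-Algebra.Left_Coset"
begin

section \<open>Smooth functions on open subsets of normed spaces\<close>

primrec Ck_on :: "nat \<Rightarrow> 'a::real_normed_vector set \<Rightarrow> ('a \<Rightarrow> 'b::real_normed_vector) \<Rightarrow> bool" where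
  "Ck_on 0 D f \<longleftrightarrow> continuous_on D f"
| "Ck_on (Suc k) D f \<longleftrightarrow> (\<forall>x\<in>D. f differentiable (at x)) \<and>
     (\<forall>v. Ck_on k D (\<lambda>x. frechet_derivative f (at x) v))"

definition smooth_on :: "'a::real_normed_vector set \<Rightarrow> ('a \<Rightarrow> 'b::real_normed_vector) \<Rightarrow> bool" where
  "smooth_on D f \<longleftrightarrow> open D \<and> (\<forall>k. Ck_on k D f)"

section \<open>Lie groups\<close>

text \<open>
  A chart is a pair of a domain and a map into the model space. The Lie algebra is the tangent space
  at the identity, identified with the model space through the distinguished chart \<open>chart_one\<close>
  around the identity: the tangent vector of a curve \<open>c\<close> with \<open>c 0 = \<one>\<close> is the derivative
  at \<open>0\<close> of its expression in that chart. The field \<open>lexp\<close> is the exponential map;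
  it is not extra data, because the last three axioms of \<open>lie_group\<close> below say that
  \<open>t \<mapsto> lexp (t v)\<close> is the one-parameter subgroup with initial velocity \<open>v\<close>.
\<close>

record ('g, 'v) lie_data = "'g monoid" +
  topol :: "'g topology"
  atlas :: "('g set \<times> ('g \<Rightarrow> 'v)) set"
  chart_one :: "'g set \<times> ('g \<Rightarrow> 'v)"
  lexp :: "'v \<Rightarrow> 'g"

definition chart_inv :: "'g set \<times> ('g \<Rightarrow> 'v) \<Rightarrow> 'v \<Rightarrow> 'g" where
  "chart_inv c = inv_into (fst c) (snd c)"

locale lie_group = group G for G :: "('g, 'v::euclidean_space) lie_data" (structure) +
  assumes topspace_topol: "topspace (topol G) = carrier G"
    and Hausdorff_topol: "Hausdorff_space (topol G)"
    and second_countable_topol: "second_countable (topol G)"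
    and chart_domain: "c \<in> atlas G \<Longrightarrow> openin (topol G) (fst c) \<and> open (snd c ` fst c)"
    and chart_homeomorphic: "c \<in> atlas G \<Longrightarrow>
      homeomorphic_map (subtopology (topol G) (fst c)) (top_of_set (snd c ` fst c)) (snd c)"
    and charts_cover: "(\<Union>c\<in>atlas G. fst c) = carrier G"
    and chart_transition: "\<lbrakk>c \<in> atlas G; d \<in> atlas G\<rbrakk> \<Longrightarrow>
      smooth_on (snd c ` (fst c \<inter> fst d)) (snd d \<circ> chart_inv c)"
    and continuous_mult:
      "continuous_map (prod_topology (topol G) (topol G)) (topol G) (\<lambda>(g, h). g \<otimes> h)"
    and continuous_inv: "continuous_map (topol G) (topol G) (\<lambda>g. inv g)"
    and smooth_mult: "\<lbrakk>c \<in> atlas G; d \<in> atlas G; e \<in> atlas G\<rbrakk> \<Longrightarrow>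
      smooth_on
        {(u, v). u \<in> snd c ` fst c \<and> v \<in> snd d ` fst d \<and> chart_inv c u \<otimes> chart_inv d v \<in> fst e}
        (\<lambda>(u, v). snd e (chart_inv c u \<otimes> chart_inv d v))"
    and smooth_inv: "\<lbrakk>c \<in> atlas G; d \<in> atlas G\<rbrakk> \<Longrightarrow>
      smooth_on {u. u \<in> snd c ` fst c \<and> inv (chart_inv c u) \<in> fst d}
        (\<lambda>u. snd d (inv (chart_inv c u)))"
    and chart_one: "chart_one G \<in> atlas G \<and> \<one> \<in> fst (chart_one G)"
    and lexp_hom: "lexp G ((s + t) *\<^sub>R v) = lexp G (s *\<^sub>R v) \<otimes> lexp G (t *\<^sub>R v)"
    and lexp_continuous: "continuous_map euclideanreal (topol G) (\<lambda>t. lexp G (t *\<^sub>R v))"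
    and lexp_velocity:
      "((\<lambda>t. snd (chart_one G) (lexp G (t *\<^sub>R v))) has_vector_derivative v) (at 0)"

text \<open>The adjoint representation: the differential at the identity of conjugation.\<close>

definition Ad :: "('g, 'v::real_normed_vector) lie_data \<Rightarrow> 'g \<Rightarrow> 'v \<Rightarrow> 'v" where
  "Ad G g = frechet_derivative
     (\<lambda>u. snd (chart_one G) (g \<otimes>\<^bsub>G\<^esub> chart_inv (chart_one G) u \<otimes>\<^bsub>G\<^esub> inv\<^bsub>G\<^esub> g))
     (at (snd (chart_one G) \<one>\<^bsub>G\<^esub>))"

text \<open>The Lie algebra of a closed subgroup.\<close>

definition subgroup_algebra :: "('g, 'v::real_normed_vector) lie_data \<Rightarrow> 'g set \<Rightarrow> 'v set" where
  "subgroup_algebra G K = {v. \<forall>t. lexp G (t *\<^sub>R v) \<in> K}"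

section \<open>Homogeneous spaces\<close>

text \<open>The points of \<open>G/K\<close> are the left cosets of \<open>K\<close>; the base point \<open>o\<close> is \<open>K\<close> itself.\<close>

definition proj :: "('g, 'v) lie_data \<Rightarrow> 'g set \<Rightarrow> 'g \<Rightarrow> 'g set" where
  "proj G K g = g <#\<^bsub>G\<^esub> K"

definition act :: "('g, 'v) lie_data \<Rightarrow> 'g \<Rightarrow> 'g set \<Rightarrow> 'g set" where
  "act G g x = g <#\<^bsub>G\<^esub> x"

definition quot_top :: "('g, 'v) lie_data \<Rightarrow> 'g set \<Rightarrow> 'g set topology" where
  "quot_top G K = topology (\<lambda>W. W \<subseteq> lcosets\<^bsub>G\<^esub> K \<and>
     openin (topol G) {g \<in> carrier G. proj G K g \<in> W})"

lemma openin_quot_top: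
  "openin (quot_top G K) W \<longleftrightarrow>
    W \<subseteq> lcosets\<^bsub>G\<^esub> K \<and> openin (topol G) {g \<in> carrier G. proj G K g \<in> W}"
proof -
  have "istopology (\<lambda>W. W \<subseteq> lcosets\<^bsub>G\<^esub> K \<and> openin (topol G) {g \<in> carrier G. proj G K g \<in> W})"
    unfolding istopology_def
  proof (intro conjI allI impI)
    fix U W
    assume U: "U \<subseteq> lcosets\<^bsub>G\<^esub> K \<and> openin (topol G) {g \<in> carrier G. proj G K g \<in> U}"
      and W: "W \<subseteq> lcosets\<^bsub>G\<^esub> K \<and> openin (topol G) {g \<in> carrier G. proj G K g \<in> W}"
    show "U \<inter> W \<subseteq> lcosets\<^bsub>G\<^esub> K" using U by blast
    have "{g \<in> carrier G. proj G K g \<in> U \<inter> W} =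
        {g \<in> carrier G. proj G K g \<in> U} \<inter> {g \<in> carrier G. proj G K g \<in> W}" by blast
    then show "openin (topol G) {g \<in> carrier G. proj G K g \<in> U \<inter> W}"
      using U W by (simp only: openin_Int)
  next
    fix \<W>
    assume W: "\<forall>W\<in>\<W>. W \<subseteq> lcosets\<^bsub>G\<^esub> K \<and> openin (topol G) {g \<in> carrier G. proj G K g \<in> W}"
    show "\<Union>\<W> \<subseteq> lcosets\<^bsub>G\<^esub> K" using W by blast
    have "{g \<in> carrier G. proj G K g \<in> \<Union>\<W>} = (\<Union>W\<in>\<W>. {g \<in> carrier G. proj G K g \<in> W})" by blast
    moreover have "openin (topol G) (\<Union>W\<in>\<W>. {g \<in> carrier G. proj G K g \<in> W})"
      using W by (intro openin_Union) auto
    ultimately show "openin (topol G) {g \<in> carrier G. proj G K g \<in> \<Union>\<W>}" by (simp only:)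
  qed
  then show ?thesis unfolding quot_top_def by (simp only: topology_inverse')
qed

definition borel_of_top :: "'a topology \<Rightarrow> 'a measure" where
  "borel_of_top T = sigma (topspace T) (Collect (openin T))"

abbreviation quot_borel :: "('g, 'v) lie_data \<Rightarrow> 'g set \<Rightarrow> 'g set measure" where
  "quot_borel G K \<equiv> borel_of_top (quot_top G K)"

text \<open>
  The manifold structure of \<open>G/K\<close> is the one making the projection a smooth submersion: a
  function on an open subset of \<open>G/K\<close> is smooth iff its composition with the projection is.
\<close>

definition smooth_quot_on :: "('g, 'v::real_normed_vector) lie_data \<Rightarrow> 'g set \<Rightarrow> 'g set set \<Rightarrow>
    ('g set \<Rightarrow> real) \<Rightarrow> bool" where
  "smooth_quot_on G K W f \<longleftrightarrow> (\<forall>c\<in>atlas G.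
     smooth_on (snd c ` {g \<in> fst c. proj G K g \<in> W}) (\<lambda>u. f (proj G K (chart_inv c u))))"

definition Cc_smooth :: "('g, 'v::real_normed_vector) lie_data \<Rightarrow> 'g set \<Rightarrow> ('g set \<Rightarrow> real) set" where
  "Cc_smooth G K = {f. smooth_quot_on G K (lcosets\<^bsub>G\<^esub> K) f \<and>
     compactin (quot_top G K) (quot_top G K closure_of {x \<in> lcosets\<^bsub>G\<^esub> K. f x \<noteq> 0})}"

locale homogeneous_space = lie_group G
  for G :: "('g, 'v::euclidean_space) lie_data" (structure) +
  fixes K :: "'g set" and \<pp> :: "'v set"
  assumes subgroup_K: "subgroup K G"
    and closed_K: "closedin (topol G) K"
    and subspace_p: "subspace \<pp>"
    and Ad_invariant_p: "k \<in> K \<Longrightarrow> Ad G k ` \<pp> \<subseteq> \<pp>"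
    and p_disjoint: "\<pp> \<inter> subgroup_algebra G K = {0}"
    and p_complement: "\<exists>u\<in>\<pp>. \<exists>w\<in>subgroup_algebra G K. v = u + w"

definition Ad_irreducible :: "('g, 'v::real_normed_vector) lie_data \<Rightarrow> 'g set \<Rightarrow> 'v set \<Rightarrow> bool" where
  "Ad_irreducible G K \<pp> \<longleftrightarrow>
     (\<forall>W. subspace W \<and> W \<subseteq> \<pp> \<and> (\<forall>k\<in>K. Ad G k ` W \<subseteq> W) \<longrightarrow> W = {0} \<or> W = \<pp>)"

definition indexed_basis :: "('n \<Rightarrow> 'v::real_vector) \<Rightarrow> 'v set \<Rightarrow> bool" where
  "indexed_basis \<xi> \<pp> \<longleftrightarrow> inj \<xi> \<and> independent (range \<xi>) \<and> span (range \<xi>) = \<pp>"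

definition Ad_invariant_inner :: "('g, 'v::real_normed_vector) lie_data \<Rightarrow> 'g set \<Rightarrow> 'v set \<Rightarrow>
    ('v \<Rightarrow> 'v \<Rightarrow> real) \<Rightarrow> bool" where
  "Ad_invariant_inner G K \<pp> ip \<longleftrightarrow>
     (\<forall>u\<in>\<pp>. \<forall>v\<in>\<pp>. \<forall>w\<in>\<pp>. ip (u + v) w = ip u w + ip v w) \<and>
     (\<forall>u\<in>\<pp>. \<forall>v\<in>\<pp>. \<forall>r. ip (r *\<^sub>R u) v = r * ip u v) \<and>
     (\<forall>u\<in>\<pp>. \<forall>v\<in>\<pp>. ip u v = ip v u) \<and>
     (\<forall>u\<in>\<pp>. u \<noteq> 0 \<longrightarrow> 0 < ip u u) \<and>
     (\<forall>k\<in>K. \<forall>u\<in>\<pp>. \<forall>v\<in>\<pp>. ip (Ad G k u) (Ad G k v) = ip u v)"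

definition Ad_orthonormal :: "('g, 'v::real_normed_vector) lie_data \<Rightarrow> 'g set \<Rightarrow> 'v set \<Rightarrow>
    ('n \<Rightarrow> 'v) \<Rightarrow> bool" where
  "Ad_orthonormal G K \<pp> \<xi> \<longleftrightarrow> (\<exists>ip. Ad_invariant_inner G K \<pp> ip \<and>
     (\<forall>i j. ip (\<xi> i) (\<xi> j) = (if i = j then 1 else 0)))"

definition lin_comb :: "('n::finite \<Rightarrow> 'v::real_vector) \<Rightarrow> ('n \<Rightarrow> real) \<Rightarrow> 'v" where
  "lin_comb \<xi> c = (\<Sum>i\<in>UNIV. c i *\<^sub>R \<xi> i)"

text \<open>\<open>exp_coord c\<close> is \<open>exp (\<Sum>i. c i \<xi>\<^sub>i) o\<close>.\<close>

definition exp_coord :: "('g, 'v::real_vector) lie_data \<Rightarrow> 'g set \<Rightarrow> ('n::finite \<Rightarrow> 'v) \<Rightarrow>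
    ('n \<Rightarrow> real) \<Rightarrow> 'g set" where
  "exp_coord G K \<xi> c = proj G K (lexp G (lin_comb \<xi> c))"

text \<open>
  \<open>V\<close> is a convex neighbourhood of \<open>0\<close> in \<open>\<pp>\<close> that \<open>\<pi> \<circ> exp\<close> maps diffeomorphically onto an open
  neighbourhood of \<open>o\<close>. With \<open>\<pp>\<close> identified with \<open>\<real>\<^sup>n\<close> through the basis \<open>\<xi>\<close>, being a
  diffeomorphism is expressed as being a homeomorphism under which the smooth functions on open
  subsets correspond.
\<close>

definition exp_diffeo_nbhd :: "('g, 'v::real_normed_vector) lie_data \<Rightarrow> 'g set \<Rightarrow> 'v set \<Rightarrow>
    ('n::finite \<Rightarrow> 'v) \<Rightarrow> 'v set \<Rightarrow> bool" where
  "exp_diffeo_nbhd G K \<pp> \<xi> V \<longleftrightarrow>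
     (let D = {c :: real ^ 'n. lin_comb \<xi> (($) c) \<in> V};
          F = (\<lambda>c :: real ^ 'n. exp_coord G K \<xi> (($) c))
      in convex V \<and> V \<subseteq> \<pp> \<and> 0 \<in> V \<and> open D \<and> openin (quot_top G K) (F ` D) \<and>
         homeomorphic_map (top_of_set D) (subtopology (quot_top G K) (F ` D)) F \<and>
         (\<forall>W f. openin (quot_top G K) W \<and> W \<subseteq> F ` D \<longrightarrow>
            smooth_quot_on G K W f = smooth_on {c \<in> D. F c \<in> W} (\<lambda>c. f (F c))))"

definition coordinate_functions :: "('g, 'v::real_normed_vector) lie_data \<Rightarrow> 'g set \<Rightarrow>
    ('n::finite \<Rightarrow> 'v) \<Rightarrow> ('n \<Rightarrow> 'g set \<Rightarrow> real) \<Rightarrow> bool" where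
  "coordinate_functions G K \<xi> \<phi> \<longleftrightarrow>
     (\<forall>i. \<phi> i \<in> Cc_smooth G K) \<and>
     (\<exists>W. openin (quot_top G K) W \<and> K \<in> W \<and> (\<forall>x\<in>W. x = exp_coord G K \<xi> (\<lambda>i. \<phi> i x))) \<and>
     (\<forall>k\<in>K. \<forall>x\<in>lcosets\<^bsub>G\<^esub> K.
        (\<Sum>i\<in>UNIV. \<phi> i x *\<^sub>R Ad G k (\<xi> i)) = (\<Sum>i\<in>UNIV. \<phi> i (act G k x) *\<^sub>R \<xi> i))"

definition K_invariant_point :: "('g, 'v) lie_data \<Rightarrow> 'g set \<Rightarrow> 'g set \<Rightarrow> bool" where
  "K_invariant_point G K x \<longleftrightarrow> x \<in> lcosets\<^bsub>G\<^esub> K \<and> (\<forall>k\<in>K. act G k x = x)"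

definition K_invariant_measure :: "('g, 'v) lie_data \<Rightarrow> 'g set \<Rightarrow> 'g set measure \<Rightarrow> bool" where
  "K_invariant_measure G K \<mu> \<longleftrightarrow> (\<forall>k\<in>K. distr \<mu> (quot_borel G K) (act G k) = \<mu>)"

section \<open>Covariance matrix functions\<close>

text \<open>The \<open>j\<close>-th column of \<open>Ad_mat\<close> consists of the coordinates of \<open>Ad k \<xi>\<^sub>j\<close>.\<close>

definition Ad_mat :: "('g, 'v::real_normed_vector) lie_data \<Rightarrow> ('n::finite \<Rightarrow> 'v) \<Rightarrow> 'g \<Rightarrow>
    real ^ 'n ^ 'n" where
  "Ad_mat G \<xi> k = (\<chi> i j. representation (range \<xi>) (Ad G k (\<xi> j)) (\<xi> i))"

definition covariance_function :: "('g, 'v::real_normed_vector) lie_data \<Rightarrow> 'g set \<Rightarrow>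
    ('n::finite \<Rightarrow> 'v) \<Rightarrow> (real \<Rightarrow> real ^ 'n ^ 'n) \<Rightarrow> bool" where
  "covariance_function G K \<xi> A \<longleftrightarrow>
     (\<forall>t\<ge>0. transpose (A t) = A t) \<and>
     (\<forall>i j. continuous_on {0..} (\<lambda>t. A t $ i $ j)) \<and>
     A 0 = 0 \<and>
     (\<forall>s t v. 0 \<le> s \<and> s < t \<longrightarrow> 0 \<le> v \<bullet> ((A t - A s) *v v)) \<and>
     (\<forall>t\<ge>0. \<forall>k\<in>K. \<forall>i j. A t $ i $ j =
        (\<Sum>p\<in>UNIV. \<Sum>q\<in>UNIV. A t $ p $ q * Ad_mat G \<xi> k $ i $ p * Ad_mat G \<xi> k $ j $ q))"

section \<open>Products in the homogeneous space\<close>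

definition borel_section :: "('g, 'v) lie_data \<Rightarrow> 'g set \<Rightarrow> ('g set \<Rightarrow> 'g) \<Rightarrow> bool" where
  "borel_section G K S \<longleftrightarrow> S \<in> quot_borel G K \<rightarrow>\<^sub>M borel_of_top (topol G) \<and>
     (\<forall>x\<in>lcosets\<^bsub>G\<^esub> K. S x \<in> carrier G \<and> proj G K (S x) = x)"

text \<open>\<open>x\<^sub>1 \<cdots> x\<^sub>m = S(x\<^sub>1) \<cdots> S(x\<^sub>m\<^sub>-\<^sub>1) x\<^sub>m\<close>; the empty product does not occur.\<close>

fun xprod :: "('g, 'v) lie_data \<Rightarrow> 'g set \<Rightarrow> ('g set \<Rightarrow> 'g) \<Rightarrow> 'g set list \<Rightarrow> 'g set" where
  "xprod G K S [] = K"
| "xprod G K S [x] = x"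
| "xprod G K S (x # y # xs) = act G (S x) (xprod G K S (y # xs))"

definition xldiv :: "('g, 'v) lie_data \<Rightarrow> ('g set \<Rightarrow> 'g) \<Rightarrow> 'g set \<Rightarrow> 'g set \<Rightarrow> 'g set" where
  "xldiv G S x y = act G (inv\<^bsub>G\<^esub> (S x)) y"

definition xinv :: "('g, 'v) lie_data \<Rightarrow> 'g set \<Rightarrow> ('g set \<Rightarrow> 'g) \<Rightarrow> 'g set \<Rightarrow> 'g set" where
  "xinv G K S b = xldiv G S b K"

definition lderiv :: "('g, 'v::real_vector) lie_data \<Rightarrow> 'g set \<Rightarrow> ('g set \<Rightarrow> 'g) \<Rightarrow>
    'v \<Rightarrow> ('g set \<Rightarrow> real) \<Rightarrow> 'g set \<Rightarrow> real" where
  "lderiv G K S v f x = deriv (\<lambda>t. f (proj G K (S x \<otimes>\<^bsub>G\<^esub> lexp G (t *\<^sub>R v)))) 0"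

definition lderiv2 :: "('g, 'v::real_vector) lie_data \<Rightarrow> 'g set \<Rightarrow> ('g set \<Rightarrow> 'g) \<Rightarrow>
    'v \<Rightarrow> 'v \<Rightarrow> ('g set \<Rightarrow> real) \<Rightarrow> 'g set \<Rightarrow> real" where
  "lderiv2 G K S v w f x = deriv (\<lambda>t. deriv (\<lambda>s.
     f (proj G K (S x \<otimes>\<^bsub>G\<^esub> lexp G (t *\<^sub>R v) \<otimes>\<^bsub>G\<^esub> lexp G (s *\<^sub>R w)))) 0) 0"

section \<open>Paths and processes\<close>

definition rcll :: "'a topology \<Rightarrow> (real \<Rightarrow> 'a) \<Rightarrow> bool" where
  "rcll T c \<longleftrightarrow> (\<forall>t\<ge>0. limitin T c (c t) (at_right t)) \<and> (\<forall>t>0. \<exists>l. limitin T c l (at_left t))"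

text \<open>In a Hausdorff space such as \<open>G/K\<close> the left limit is unique.\<close>

definition left_lim :: "'a topology \<Rightarrow> (real \<Rightarrow> 'a) \<Rightarrow> real \<Rightarrow> 'a" where
  "left_lim T c t = (SOME l. limitin T c l (at_left t))"

definition natural_filtration :: "'w measure \<Rightarrow> 'a measure \<Rightarrow> (real \<Rightarrow> 'w \<Rightarrow> 'a) \<Rightarrow> real \<Rightarrow> 'w measure" where
  "natural_filtration M E x t =
     sigma (space M) (\<Union>u\<in>{0..t}. {x u -` B \<inter> space M | B. B \<in> sets E})"

definition martingale :: "'w measure \<Rightarrow> (real \<Rightarrow> 'w measure) \<Rightarrow> (real \<Rightarrow> 'w \<Rightarrow> real) \<Rightarrow> bool" where
  "martingale M F Y \<longleftrightarrow>
     (\<forall>t\<ge>0. Y t \<in> borel_measurable (F t) \<and> integrable M (Y t)) \<and>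
     (\<forall>s t. 0 \<le> s \<and> s \<le> t \<longrightarrow> (AE \<omega> in M. real_cond_exp M (F s) (Y t) \<omega> = Y s \<omega>))"

definition transition_function :: "'a measure \<Rightarrow> (real \<Rightarrow> real \<Rightarrow> 'a \<Rightarrow> 'a measure) \<Rightarrow> bool" where
  "transition_function E P \<longleftrightarrow>
     (\<forall>s t. 0 \<le> s \<and> s \<le> t \<longrightarrow> P s t \<in> E \<rightarrow>\<^sub>M prob_algebra E) \<and>
     (\<forall>t\<ge>0. \<forall>x\<in>space E. P t t x = return E x) \<and>
     (\<forall>s t u. 0 \<le> s \<and> s \<le> t \<and> t \<le> u \<longrightarrow> (\<forall>x\<in>space E. P s u x = P s t x \<bind> P t u))"

definition markov_process :: "'w measure \<Rightarrow> 'a measure \<Rightarrow> (real \<Rightarrow> real \<Rightarrow> 'a \<Rightarrow> 'a measure) \<Rightarrow>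
    (real \<Rightarrow> 'w \<Rightarrow> 'a) \<Rightarrow> bool" where
  "markov_process M E P x \<longleftrightarrow> prob_space M \<and> transition_function E P \<and>
     (\<forall>t\<ge>0. x t \<in> M \<rightarrow>\<^sub>M E) \<and>
     (\<forall>s t. \<forall>B\<in>sets E. 0 \<le> s \<and> s \<le> t \<longrightarrow>
        (AE \<omega> in M. real_cond_exp M (natural_filtration M E x s) (\<lambda>\<omega>. indicator B (x t \<omega>)) \<omega> =
           measure (P s t (x s \<omega>)) B))"

definition inhomogeneous_levy :: "('g, 'v) lie_data \<Rightarrow> 'g set \<Rightarrow> 'w measure \<Rightarrow>
    (real \<Rightarrow> 'w \<Rightarrow> 'g set) \<Rightarrow> bool" where
  "inhomogeneous_levy G K M x \<longleftrightarrow>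
     (\<forall>\<omega>\<in>space M. rcll (quot_top G K) (\<lambda>t. x t \<omega>)) \<and>
     (\<exists>P. markov_process M (quot_borel G K) P x \<and>
        (\<forall>s t. \<forall>g\<in>carrier G. \<forall>y\<in>lcosets\<^bsub>G\<^esub> K. \<forall>f\<in>borel_measurable (quot_borel G K). 0 \<le> s \<and> s < t \<longrightarrow>
           (\<integral>\<^sup>+ z. f (act G g z) \<partial>P s t y) = (\<integral>\<^sup>+ z. f z \<partial>P s t (act G g y))))"

section \<open>Extended Levy measure functions\<close>

text \<open>
  Setwise right continuity at \<open>t\<close> is required on sets that have finite measure at some later time.
  For sets of infinite measure it would fail even for \<open>\<eta>(t, dx) = t \<mu>(dx)\<close> with \<open>\<mu>\<close> infinite.
\<close>

definition measure_function :: "'a measure \<Rightarrow> (real \<Rightarrow> 'a measure) \<Rightarrow> bool" where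
  "measure_function E \<eta> \<longleftrightarrow>
     (\<forall>t\<ge>0. sets (\<eta> t) = sets E \<and> sigma_finite_measure (\<eta> t)) \<and>
     (\<forall>s t. \<forall>B\<in>sets E. 0 \<le> s \<and> s \<le> t \<longrightarrow> emeasure (\<eta> s) B \<le> emeasure (\<eta> t) B) \<and>
     (\<forall>t\<ge>0. \<forall>u>t. \<forall>B\<in>sets E. emeasure (\<eta> u) B < \<infinity> \<longrightarrow>
        ((\<lambda>s. emeasure (\<eta> s) B) \<longlongrightarrow> emeasure (\<eta> t) B) (at_right t))"

text \<open>\<open>N\<close> is the measure \<open>\<eta>(dt, dx)\<close> on \<open>\<real>\<^sub>+ \<times> X\<close> that is identified with \<open>\<eta>\<close>.\<close>

definition space_time_measure :: "'a measure \<Rightarrow> (real \<Rightarrow> 'a measure) \<Rightarrow> (real \<times> 'a) measure \<Rightarrow> bool" where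
  "space_time_measure E \<eta> N \<longleftrightarrow>
     sets N = sets (restrict_space borel {0..} \<Otimes>\<^sub>M E) \<and>
     (\<forall>t\<ge>0. \<forall>B\<in>sets E. emeasure N ({0..t} \<times> B) = emeasure (\<eta> t) B)"

definition jump_times :: "'a measure \<Rightarrow> (real \<times> 'a) measure \<Rightarrow> real set" where
  "jump_times E N = {t. 0 < t \<and> 0 < emeasure N ({t} \<times> space E)}"

definition continuous_part :: "'a measure \<Rightarrow> (real \<times> 'a) measure \<Rightarrow> (real \<times> 'a) measure" where
  "continuous_part E N = density N (\<lambda>(s, x). indicator (- jump_times E N) s)"

definition jump_law :: "('g, 'v) lie_data \<Rightarrow> 'g set \<Rightarrow> (real \<times> 'g set) measure \<Rightarrow> real \<Rightarrow>
    'g set measure" where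
  "jump_law G K N t = measure_of (lcosets\<^bsub>G\<^esub> K) (sets (quot_borel G K))
     (\<lambda>B. emeasure N ({t} \<times> B) + (1 - emeasure N ({t} \<times> lcosets\<^bsub>G\<^esub> K)) * indicator B K)"

definition jump_mean :: "('g, 'v::real_vector) lie_data \<Rightarrow> 'g set \<Rightarrow> ('n::finite \<Rightarrow> 'v) \<Rightarrow>
    ('n \<Rightarrow> 'g set \<Rightarrow> real) \<Rightarrow> (real \<times> 'g set) measure \<Rightarrow> real \<Rightarrow> 'g set" where
  "jump_mean G K \<xi> \<phi> N t = exp_coord G K \<xi> (\<lambda>i. LINT x|jump_law G K N t. \<phi> i x)"

definition extended_levy_measure :: "('g, 'v::real_vector) lie_data \<Rightarrow> 'g set \<Rightarrow> ('n::finite \<Rightarrow> 'v) \<Rightarrow>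
    ('n \<Rightarrow> 'g set \<Rightarrow> real) \<Rightarrow> (real \<Rightarrow> 'g set measure) \<Rightarrow> (real \<times> 'g set) measure \<Rightarrow> bool" where
  "extended_levy_measure G K \<xi> \<phi> \<eta> N \<longleftrightarrow>
     measure_function (quot_borel G K) \<eta> \<and> space_time_measure (quot_borel G K) \<eta> N \<and>
     (\<forall>t\<ge>0. K_invariant_measure G K (\<eta> t)) \<and>
     (\<forall>B\<in>sets (quot_borel G K). emeasure (\<eta> 0) B = 0) \<and>
     (\<forall>t\<ge>0. emeasure (\<eta> t) {K} = 0 \<and>
        (\<forall>W. openin (quot_top G K) W \<and> K \<in> W \<longrightarrow> emeasure (\<eta> t) (lcosets\<^bsub>G\<^esub> K - W) < \<infinity>) \<and>
        (\<integral>\<^sup>+ (s, x) \<in> {0..t} \<times> lcosets\<^bsub>G\<^esub> K. ennreal (\<Sum>i\<in>UNIV. (\<phi> i x)\<^sup>2)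
           \<partial>continuous_part (quot_borel G K) N) < \<infinity> \<and>
        emeasure N ({t} \<times> lcosets\<^bsub>G\<^esub> K) \<le> 1 \<and>
        (\<Sum>\<^sub>\<infinity>s\<in>{0..t}. \<integral>\<^sup>+ x. ennreal (\<Sum>i\<in>UNIV. (\<phi> i x - \<phi> i (jump_mean G K \<xi> \<phi> N s))\<^sup>2)
           \<partial>jump_law G K N s) < \<infinity>)"

section \<open>Extended Levy triples\<close>

definition extended_drift :: "('g, 'v) lie_data \<Rightarrow> 'g set \<Rightarrow> (real \<Rightarrow> 'g set) \<Rightarrow> bool" where
  "extended_drift G K b \<longleftrightarrow>
     rcll (quot_top G K) b \<and> (\<forall>t\<ge>0. K_invariant_point G K (b t)) \<and> b 0 = K"

definition extended_levy_triple :: "('g, 'v::real_normed_vector) lie_data \<Rightarrow> 'g set \<Rightarrow>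
    ('n::finite \<Rightarrow> 'v) \<Rightarrow> ('g set \<Rightarrow> 'g) \<Rightarrow> ('n \<Rightarrow> 'g set \<Rightarrow> real) \<Rightarrow> (real \<Rightarrow> 'g set) \<Rightarrow>
    (real \<Rightarrow> real ^ 'n ^ 'n) \<Rightarrow> (real \<Rightarrow> 'g set measure) \<Rightarrow> (real \<times> 'g set) measure \<Rightarrow> bool" where
  "extended_levy_triple G K \<xi> S \<phi> b A \<eta> N \<longleftrightarrow>
     extended_drift G K b \<and> covariance_function G K \<xi> A \<and> extended_levy_measure G K \<xi> \<phi> \<eta> N \<and>
     (\<forall>t>0. xldiv G S (left_lim (quot_top G K) b t) (b t) = jump_mean G K \<xi> \<phi> N t)"

text \<open>
  \<open>cov_integral A j k t g\<close> is \<open>\<integral>\<^sub>0\<^sup>t g(s) dA\<^sub>j\<^sub>k(s)\<close>. For a covariance matrix function, \<open>A\<^sub>j\<^sub>k\<close> is half of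
  \<open>(A\<^sub>j\<^sub>j + A\<^sub>k\<^sub>k + 2 A\<^sub>j\<^sub>k) - A\<^sub>j\<^sub>j - A\<^sub>k\<^sub>k\<close>, a combination of nondecreasing continuous functions.
\<close>

definition stieltjes :: "(real \<Rightarrow> real) \<Rightarrow> real \<Rightarrow> (real \<Rightarrow> real) \<Rightarrow> real" where
  "stieltjes F t g = (LINT s:{0..t}|interval_measure (\<lambda>s. F (max 0 s)). g s)"

definition cov_integral :: "(real \<Rightarrow> real ^ 'n ^ 'n) \<Rightarrow> 'n \<Rightarrow> 'n \<Rightarrow> real \<Rightarrow> (real \<Rightarrow> real) \<Rightarrow> real" where
  "cov_integral A j k t g =
     (stieltjes (\<lambda>s. A s $ j $ j + A s $ k $ k + 2 * A s $ j $ k) t g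
      - stieltjes (\<lambda>s. A s $ j $ j) t g - stieltjes (\<lambda>s. A s $ k $ k) t g) / 2"

text \<open>For a fixed path, with \<open>z\<close> standing for \<open>t \<mapsto> x\<^sub>t b\<^sub>t\<^sup>-\<^sup>1\<close>.\<close>

definition levy_functional :: "('g, 'v::real_normed_vector) lie_data \<Rightarrow> 'g set \<Rightarrow>
    ('n::finite \<Rightarrow> 'v) \<Rightarrow> ('g set \<Rightarrow> 'g) \<Rightarrow> ('n \<Rightarrow> 'g set \<Rightarrow> real) \<Rightarrow> (real \<Rightarrow> 'g set) \<Rightarrow>
    (real \<Rightarrow> real ^ 'n ^ 'n) \<Rightarrow> (real \<times> 'g set) measure \<Rightarrow> ('g set \<Rightarrow> real) \<Rightarrow>
    (real \<Rightarrow> 'g set) \<Rightarrow> real \<Rightarrow> real" where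
  "levy_functional G K \<xi> S \<phi> b A N f z t =
     (let prd = xprod G K S; iv = xinv G K S;
          \<zeta> = (\<lambda>s j. Ad G (S (b s)) (\<xi> j));
          h = jump_mean G K \<xi> \<phi> N;
          zl = left_lim (quot_top G K) z;
          bl = left_lim (quot_top G K) b
      in f (z t)
         - 1 / 2 * (\<Sum>j\<in>UNIV. \<Sum>k\<in>UNIV.
             cov_integral A j k t (\<lambda>s. lderiv2 G K S (\<zeta> s j) (\<zeta> s k) f (z s)))
         - (LINT r:{0..t} \<times> lcosets\<^bsub>G\<^esub> K|continuous_part (quot_borel G K) N.
             (case r of (s, x) \<Rightarrow> f (prd [z s, b s, x, iv (b s)]) - f (z s)
                - (\<Sum>j\<in>UNIV. \<phi> j x * lderiv G K S (\<zeta> s j) f (z s))))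
         - (\<Sum>\<^sub>\<infinity>u\<in>{0<..t}. LINT x|jump_law G K N u.
             f (prd [zl u, bl u, x, iv (h u), iv (bl u)]) - f (zl u)))"

definition represents :: "('g, 'v::real_normed_vector) lie_data \<Rightarrow> 'g set \<Rightarrow>
    ('n::finite \<Rightarrow> 'v) \<Rightarrow> ('g set \<Rightarrow> 'g) \<Rightarrow> ('n \<Rightarrow> 'g set \<Rightarrow> real) \<Rightarrow> (real \<Rightarrow> 'g set) \<Rightarrow>
    (real \<Rightarrow> real ^ 'n ^ 'n) \<Rightarrow> (real \<times> 'g set) measure \<Rightarrow> 'w measure \<Rightarrow>
    (real \<Rightarrow> 'w \<Rightarrow> 'g set) \<Rightarrow> bool" where
  "represents G K \<xi> S \<phi> b A N M x \<longleftrightarrow> (\<forall>f\<in>Cc_smooth G K.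
     martingale M (natural_filtration M (quot_borel G K) x)
       (\<lambda>t \<omega>. levy_functional G K \<xi> S \<phi> b A N f
          (\<lambda>s. xprod G K S [x s \<omega>, xinv G K S (b s)]) t))"

end

theory Submission
  imports Defs
begin

text \<open>
  The matrix \<open>A(t)\<close> commutes with the orthogonal matrices of \<open>Ad(K)\<close>, so its eigenspaces are
  \<open>Ad(K)\<close>-invariant and irreducibility leaves only one. For the drift, irreducibility forces the
  \<open>Ad(K)\<close>-fixed vectors of \<open>\<pp>\<close> to vanish. By equivariance of the coordinate functions,
  \<open>\<Sum>\<^sub>i \<phi>\<^sub>i(x) \<xi>\<^sub>i\<close> is fixed if \<open>x\<close> is \<open>K\<close>-invariant, and \<open>\<Sum>\<^sub>i \<nu>\<^sub>t(\<phi>\<^sub>i) \<xi>\<^sub>i\<close> is fixed because \<open>\<nu>\<^sub>t\<close> is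
  \<open>K\<close>-invariant. The first fact isolates \<open>o\<close> among the \<open>K\<close>-invariant points, the second gives
  \<open>h\<^sub>t = o\<close>, so that \<open>b\<close> is a continuous path starting at an isolated point.
\<close>

section \<open>Adjoint action and invariant matrices\<close>

text \<open>Perturb \<open>u\<close> in the direction of its own image \<open>w = B *v u\<close>.
  The form at \<open>u + s *\<^sub>R w\<close> is a polynomial in \<open>s\<close> without constant
  term and with linear coefficient \<open>2 * (w \<bullet> w)\<close>; it can stay nonnegative for
  small negative \<open>s\<close> only if \<open>w = 0\<close>.\<close>

lemma psd_form_eq_0_imp_ker:
  fixes B :: "real ^ 'n ^ 'n"
  assumes sym: "transpose B = B" and psd: "\<And>v. 0 \<le> v \<bullet> (B *v v)" and u: "u \<bullet> (B *v u) = 0"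
  shows "B *v u = 0"
proof -
  define w where "w = B *v u"
  have swap: "u \<bullet> (B *v w) = w \<bullet> w"
    by (metis sym dot_lmul_matrix vector_transpose_matrix w_def)
  have "0 \<le> 2 * s * (w \<bullet> w) + s\<^sup>2 * (w \<bullet> (B *v w))" for s
  proof -
    have "(u + s *\<^sub>R w) \<bullet> (B *v (u + s *\<^sub>R w)) = 2 * s * (w \<bullet> w) + s\<^sup>2 * (w \<bullet> (B *v w))"
      using u swap
      by (simp add: matrix_vector_right_distrib matrix_vector_mult_scaleR inner_add_left
          inner_add_right power2_eq_square distrib_left flip: w_def)
    then show ?thesis using psd by metis
  qed
  note quad = this
  have "w \<bullet> w \<le> 0"
  proof (rule ccontr)
    assume "\<not> w \<bullet> w \<le> 0"
    then have pos: "0 < w \<bullet> w" by linarith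
    \<comment> \<open>Adding 1 to the quadratic coefficient keeps the denominator positive. The
      chosen \<open>s\<close> minimizes \<open>2 * s * (w \<bullet> w) + s\<^sup>2 * d\<close>,
      whose minimum is strictly negative.\<close>
    define d where "d = w \<bullet> (B *v w) + 1"
    have d: "0 < d" using psd[of w] by (simp add: d_def)
    define s where "s = - (w \<bullet> w) / d"
    have "2 * s * (w \<bullet> w) + s\<^sup>2 * (w \<bullet> (B *v w)) \<le> 2 * s * (w \<bullet> w) + s\<^sup>2 * d"
      by (simp add: d_def mult_left_mono)
    also have "\<dots> = - (w \<bullet> w)\<^sup>2 / d"
      using d by (simp add: s_def field_simps power2_eq_square)
    also have "\<dots> < 0" using pos d by simp
    finally show False using quad[of s] by simp
  qed
  then have "w = 0" by (meson inner_gt_zero_iff not_le)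
  then show ?thesis by (simp add: w_def)
qed

text \<open>Variational argument: a maximizer \<open>u\<close> of the quadratic form on the unit
  sphere, with maximum \<open>l\<close>, makes \<open>l *\<^sub>R mat 1 - B\<close> nonnegative
  definite with form zero at \<open>u\<close>, so \<open>u\<close> lies in its kernel.\<close>

lemma symmetric_matrix_has_eigenvector:
  fixes B :: "real ^ 'n ^ 'n"
  assumes sym: "transpose B = B"
  obtains l u where "u \<noteq> 0" "B *v u = l *\<^sub>R u"
proof -
  have "continuous_on (sphere 0 1) (\<lambda>v :: real ^ 'n. v \<bullet> (B *v v))"
    by (intro continuous_intros matrix_vector_mult_linear_continuous_on)
  from continuous_attains_sup[OF compact_sphere _ this] obtain u :: "real ^ 'n"
    where u: "norm u = 1" and max: "\<And>v. norm v = 1 \<Longrightarrow> v \<bullet> (B *v v) \<le> u \<bullet> (B *v u)"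
    by auto
  define l where "l = u \<bullet> (B *v u)"
  define C where "C = l *\<^sub>R mat 1 - B"
  have C: "C *v v = l *\<^sub>R v - B *v v" for v
    by (simp add: C_def matrix_vector_mult_diff_rdistrib flip: scaleR_matrix_vector_assoc)
  have "0 \<le> v \<bullet> (C *v v)" for v
  proof (cases "v = 0")
    case False
    define w where "w = v /\<^sub>R norm v"
    have v: "v = norm v *\<^sub>R w" and w: "norm w = 1"
      using False by (simp_all add: w_def)
    have "v \<bullet> (B *v v) = (norm v)\<^sup>2 * (w \<bullet> (B *v w))"
      by (subst (1 2) v) (simp add: matrix_vector_mult_scaleR power2_eq_square)
    also have "\<dots> \<le> (norm v)\<^sup>2 * l"
      using max[OF w] by (simp add: l_def mult_left_mono)
    finally show ?thesis
      by (simp add: C inner_diff_right dot_square_norm mult.commute)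
  qed simp
  moreover have "transpose C = C"
    using sym by (simp add: C_def transpose_def vec_eq_iff mat_def)
  moreover have "u \<bullet> (C *v u) = 0"
    using u by (simp add: C inner_diff_right l_def dot_square_norm)
  ultimately have "C *v u = 0"
    by (intro psd_form_eq_0_imp_ker)
  then have "B *v u = l *\<^sub>R u" by (simp add: C)
  moreover have "u \<noteq> 0" using u by auto
  ultimately show thesis by (rule that[rotated])
qed

section \<open>Differentiability of conjugation and linearity of the adjoint action\<close>

lemma smooth_on_imp_differentiable:
  assumes "smooth_on D f" "x \<in> D"
  shows "f differentiable (at x)"
proof -
  have "Ck_on (Suc 0) D f" using assms(1) unfolding smooth_on_def by blast
  then show ?thesis using assms(2) by simp
qed

lemma smooth_on_imp_continuous_on:
  assumes "smooth_on D f"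
  shows "continuous_on D f"
proof -
  have "Ck_on 0 D f" using assms unfolding smooth_on_def by blast
  then show ?thesis by simp
qed

context lie_group
begin

lemma chart_subset: "c \<in> atlas G \<Longrightarrow> fst c \<subseteq> carrier G"
  using openin_subset[of "topol G" "fst c"] chart_domain topspace_topol by simp

lemma chart_inv_left:
  assumes "c \<in> atlas G" "g \<in> fst c"
  shows "chart_inv c (snd c g) = g"
proof -
  have "inj_on (snd c) (fst c)"
    using homeomorphic_imp_injective_map[OF chart_homeomorphic[OF assms(1)]]
      chart_subset[OF assms(1)] topspace_topol by (simp add: inf.absorb2)
  then show ?thesis using assms(2) by (simp add: chart_inv_def inv_into_f_f)
qed

lemma continuous_map_left_mult:
  assumes "g \<in> carrier G"
  shows "continuous_map (topol G) (topol G) (\<lambda>h. g \<otimes> h)"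
proof -
  have "continuous_map (topol G) (prod_topology (topol G) (topol G)) (\<lambda>h. (g, h))"
    using assms by (intro continuous_map_pairedI) (auto simp: topspace_topol)
  from continuous_map_compose[OF this continuous_mult] show ?thesis by (simp add: o_def)
qed

text \<open>A \<open>frechet_derivative\<close> is meaningful only for a differentiable map, so this
  is what gives \<open>Ad\<close> its content. Conjugation is written as left multiplication by
  \<open>k\<close> followed by right multiplication by \<open>inv k\<close>, passing through a chart
  \<open>d\<close> around \<open>k\<close>; each factor is the smooth multiplication in charts with
  one argument frozen.\<close>

lemma conjugation_differentiable:
  assumes k: "k \<in> carrier G"
  shows "(\<lambda>u. snd (chart_one G) (k \<otimes> chart_inv (chart_one G) u \<otimes> inv k))
    differentiable (at (snd (chart_one G) \<one>))"
proof -
  let ?c = "chart_one G"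
  let ?u = "snd ?c \<one>"
  have c: "?c \<in> atlas G" "\<one> \<in> fst ?c" using chart_one by auto
  obtain d where d: "d \<in> atlas G" "k \<in> fst d" using k charts_cover by blast
  obtain e where e: "e \<in> atlas G" "inv k \<in> fst e" using k charts_cover inv_closed by blast
  let ?M1 = "{(u, v). u \<in> snd d ` fst d \<and> v \<in> snd ?c ` fst ?c \<and> chart_inv d u \<otimes> chart_inv ?c v \<in> fst d}"
  let ?f1 = "\<lambda>(u, v). snd d (chart_inv d u \<otimes> chart_inv ?c v)"
  let ?M2 = "{(u, v). u \<in> snd d ` fst d \<and> v \<in> snd e ` fst e \<and> chart_inv d u \<otimes> chart_inv e v \<in> fst ?c}"
  let ?f2 = "\<lambda>(u, v). snd ?c (chart_inv d u \<otimes> chart_inv e v)"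
  have s1: "smooth_on ?M1 ?f1" and s2: "smooth_on ?M2 ?f2" using smooth_mult c d e by blast+
  have m1: "(snd d k, ?u) \<in> ?M1" using c d k by (auto simp: chart_inv_left)
  have m2: "(snd d k, snd e (inv k)) \<in> ?M2" using c d e k by (auto simp: chart_inv_left)
  let ?L = "\<lambda>v. ?f1 (snd d k, v)"
  let ?R = "\<lambda>w. ?f2 (w, snd e (inv k))"
  have Lu: "?L ?u = snd d k" using c d k by (simp add: chart_inv_left)
  have "?L differentiable (at ?u)"
    by (rule differentiable_compose[of ?f1]) (use smooth_on_imp_differentiable[OF s1 m1] in \<open>auto intro!: differentiable_Pair\<close>)
  moreover have "?R differentiable (at (?L ?u))"
    unfolding Lu
    by (rule differentiable_compose[of ?f2]) (use smooth_on_imp_differentiable[OF s2 m2] in \<open>auto intro!: differentiable_Pair\<close>)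
  ultimately have diff: "(\<lambda>v. ?R (?L v)) differentiable (at ?u)"
    by (rule differentiable_compose[rotated])
  \<comment> \<open>On this neighbourhood of the identity coordinate the intermediate product stays
    in the domain of \<open>d\<close>, so entering and leaving \<open>d\<close> cancels and the
    composite is conjugation itself.\<close>
  define O1 where "O1 = {v. (snd d k, v) \<in> ?M1}"
  have "O1 = Pair (snd d k) -` ?M1" by (auto simp: O1_def)
  moreover have "open ?M1" using s1 by (simp add: smooth_on_def)
  ultimately have "open O1" by (simp only:) (rule open_vimage, auto intro!: continuous_intros)
  moreover have "?u \<in> O1" using m1 by (simp add: O1_def)
  moreover have eq: "?R (?L v) = snd ?c (k \<otimes> chart_inv ?c v \<otimes> inv k)" if "v \<in> O1" for v
    using that d e by (auto simp: O1_def chart_inv_left)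
  moreover obtain D where der: "((\<lambda>v. ?R (?L v)) has_derivative D) (at ?u)"
    using diff by (auto simp: differentiable_def)
  ultimately have "((\<lambda>u. snd ?c (k \<otimes> chart_inv ?c u \<otimes> inv k)) has_derivative D) (at ?u)"
    by (intro has_derivative_transform_within_open[OF der _ _ eq])
  then show ?thesis by (rule differentiableI)
qed

lemma linear_Ad:
  assumes "k \<in> carrier G"
  shows "linear (Ad G k)"
  using conjugation_differentiable[OF assms] unfolding Ad_def frechet_derivative_works
  by (rule has_derivative_linear)

end

section \<open>Coordinates with respect to the basis\<close>

lemma linear_lin_comb: "linear (\<lambda>v :: real ^ 'n. lin_comb \<xi> (($) v))"
  by (rule linearI) (simp_all add: lin_comb_def scaleR_add_left sum.distrib scaleR_sum_right)

context
  fixes \<xi> :: "'n::finite \<Rightarrow> 'v::euclidean_space" and \<pp>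
  assumes basis: "indexed_basis \<xi> \<pp>"
begin

lemma lin_comb_in: "lin_comb \<xi> c \<in> \<pp>"
proof -
  have "\<pp> = span (range \<xi>)" using basis by (simp add: indexed_basis_def)
  then show ?thesis by (simp add: lin_comb_def span_sum span_scale span_base)
qed

lemma lin_comb_representation:
  assumes "v \<in> \<pp>"
  shows "lin_comb \<xi> (\<lambda>i. representation (range \<xi>) v (\<xi> i)) = v"
proof -
  have b: "inj \<xi>" "independent (range \<xi>)" "span (range \<xi>) = \<pp>"
    using basis by (auto simp: indexed_basis_def)
  have "(\<Sum>w\<in>range \<xi>. representation (range \<xi>) v w *\<^sub>R w) = v"
    using sum_representation_eq[of "range \<xi>" v "range \<xi>"] b assms by simp
  then show ?thesis
    using sum.reindex[OF b(1), of "\<lambda>w. representation (range \<xi>) v w *\<^sub>R w"] by (simp add: lin_comb_def)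
qed

lemma inj_lin_comb: "inj (\<lambda>v :: real ^ 'n. lin_comb \<xi> (($) v))"
proof (rule injI)
  fix v w :: "real ^ 'n"
  assume "lin_comb \<xi> (($) v) = lin_comb \<xi> (($) w)"
  then have "(\<Sum>i\<in>UNIV. (v $ i - w $ i) *\<^sub>R \<xi> i) = 0"
    by (simp add: lin_comb_def scaleR_diff_left sum_subtractf)
  moreover have b: "inj \<xi>" "independent (range \<xi>)" using basis by (auto simp: indexed_basis_def)
  \<comment> \<open>Independence speaks of coefficients attached to vectors, so the coefficients are
    moved from indices to basis vectors along the injection \<open>\<xi>\<close>.\<close>
  moreover define f where "f = (\<lambda>x. v $ inv_into UNIV \<xi> x - w $ inv_into UNIV \<xi> x)"
  ultimately have "(\<Sum>x\<in>range \<xi>. f x *\<^sub>R x) = 0"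
    by (simp add: sum.reindex f_def)
  then have "\<forall>x\<in>range \<xi>. f x = 0"
    using b(2) by (auto simp: independent_explicit)
  then show "v = w" using b(1) by (simp add: vec_eq_iff f_def)
qed

text \<open>This passes between the action on \<open>\<pp>\<close>, where irreducibility is stated,
  and matrices acting on coordinate vectors. Invariance of \<open>\<pp>\<close> ensures that
  \<open>Ad G k (\<xi> j)\<close> is recovered from its column of coordinates.\<close>

lemma Ad_lin_comb:
  assumes "linear (Ad G k)" "Ad G k ` \<pp> \<subseteq> \<pp>"
  shows "Ad G k (lin_comb \<xi> (($) v)) = lin_comb \<xi> (($) (Ad_mat G \<xi> k *v v))"
proof -
  have in_p: "Ad G k (\<xi> j) \<in> \<pp>" for j
    using assms(2) basis span_base[of "\<xi> j" "range \<xi>"] by (auto simp: indexed_basis_def)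
  have "Ad G k (lin_comb \<xi> (($) v)) = (\<Sum>j\<in>UNIV. v $ j *\<^sub>R Ad G k (\<xi> j))"
    using assms(1) by (simp add: lin_comb_def linear_sum linear_scale)
  also have "\<dots> = (\<Sum>j\<in>UNIV. v $ j *\<^sub>R lin_comb \<xi> (\<lambda>i. Ad_mat G \<xi> k $ i $ j))"
    using lin_comb_representation[OF in_p] by (simp add: Ad_mat_def)
  also have "\<dots> = lin_comb \<xi> (($) (Ad_mat G \<xi> k *v v))"
    unfolding lin_comb_def matrix_vector_mult_def
    by (simp add: scaleR_sum_right scaleR_sum_left, subst sum.swap, simp add: mult.commute)
  finally show ?thesis .
qed

end

lemma Ad_invariant_inner_lin_comb:
  fixes \<xi> :: "'n::finite \<Rightarrow> 'v::euclidean_space"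
  assumes basis: "indexed_basis \<xi> \<pp>" and ip: "Ad_invariant_inner G K \<pp> ip"
    and orth: "\<And>i j. ip (\<xi> i) (\<xi> j) = (if i = j then 1 else 0)"
  shows "ip (lin_comb \<xi> (($) v)) (lin_comb \<xi> (($) w)) = v \<bullet> w"
proof -
  have add: "ip (u + v) w = ip u w + ip v w" and scale: "ip (r *\<^sub>R u) v = r * ip u v"
    and sym: "ip u v = ip v u" if "u \<in> \<pp>" "v \<in> \<pp>" "w \<in> \<pp>" for u v w r
    using ip that unfolding Ad_invariant_inner_def by blast+
  have sub: "subspace \<pp>" and \<xi>: "\<xi> i \<in> \<pp>" for i
    using basis by (auto simp: indexed_basis_def intro: span_base)
  have ip_sum: "ip (\<Sum>i\<in>I. c i *\<^sub>R \<xi> i) w = (\<Sum>i\<in>I. c i * ip (\<xi> i) w)"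
    if "w \<in> \<pp>" for c w and I :: "'n set"
    using finite[of I]
  proof induction
    case empty
    show ?case using scale[of 0 w w 0] that sub by (simp add: subspace_0)
  next
    case (insert i I)
    then show ?case
      using sub \<xi> that by (simp add: add scale subspace_sum subspace_scale)
  qed
  have "ip (\<xi> i) (lin_comb \<xi> (($) w)) = w $ i" for i
    using lin_comb_in[OF basis] \<xi>
    by (subst sym) (auto simp: lin_comb_def ip_sum orth if_distrib cong: if_cong)
  then show ?thesis
    using lin_comb_in[OF basis] by (subst lin_comb_def) (simp add: ip_sum inner_vec_def)
qed

text \<open>In an orthonormal basis the invariant inner product becomes the dot product of
  coordinates, so its invariance says that the matrix preserves dot products.\<close>

lemma orthogonal_Ad_mat:
  fixes \<xi> :: "'n::finite \<Rightarrow> 'v::euclidean_space"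
  assumes basis: "indexed_basis \<xi> \<pp>" and orth: "Ad_orthonormal G K \<pp> \<xi>"
    and k: "k \<in> K" and Ad: "linear (Ad G k)" "Ad G k ` \<pp> \<subseteq> \<pp>"
  shows "orthogonal_matrix (Ad_mat G \<xi> k)"
proof -
  obtain ip where ip: "Ad_invariant_inner G K \<pp> ip"
    and on: "\<And>i j. ip (\<xi> i) (\<xi> j) = (if i = j then 1 else 0)"
    using orth by (auto simp: Ad_orthonormal_def)
  have "(Ad_mat G \<xi> k *v v) \<bullet> (Ad_mat G \<xi> k *v w) = v \<bullet> w" for v w
  proof -
    have "ip (Ad G k (lin_comb \<xi> (($) v))) (Ad G k (lin_comb \<xi> (($) w))) =
        ip (lin_comb \<xi> (($) v)) (lin_comb \<xi> (($) w))"
      using ip k lin_comb_in[OF basis] by (simp add: Ad_invariant_inner_def)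
    then show ?thesis
      by (simp add: Ad_lin_comb[OF basis Ad] Ad_invariant_inner_lin_comb[OF basis ip on])
  qed
  then have "orthogonal_transformation ((*v) (Ad_mat G \<xi> k))"
    by (simp add: orthogonal_transformation_def)
  then show ?thesis by (simp add: orthogonal_transformation_matrix)
qed

section \<open>Schur's lemma for symmetric matrices\<close>

context homogeneous_space
begin

lemma K_subset: "K \<subseteq> carrier G"
  using subgroup_K by (rule subgroup.subset)

lemma linear_Ad_K: "k \<in> K \<Longrightarrow> linear (Ad G k)"
  using K_subset linear_Ad by blast

text \<open>The hypothesis \<open>inv\<close> is \<open>B = Q ** B ** transpose Q\<close> in
  entries, which for orthogonal \<open>Q\<close> means commutation. Symmetry supplies a real
  eigenvalue, so one eigenspace is nonzero and invariant and irreducibility makes it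
  everything.\<close>

lemma Ad_invariant_matrix_eq_scalar:
  fixes \<xi> :: "'n::finite \<Rightarrow> 'v" and B :: "real ^ 'n ^ 'n"
  assumes irred: "Ad_irreducible G K \<pp>" and basis: "indexed_basis \<xi> \<pp>"
    and orth: "Ad_orthonormal G K \<pp> \<xi>" and sym: "transpose B = B"
    and inv: "\<And>k i j. k \<in> K \<Longrightarrow> B $ i $ j =
      (\<Sum>p\<in>UNIV. \<Sum>q\<in>UNIV. B $ p $ q * Ad_mat G \<xi> k $ i $ p * Ad_mat G \<xi> k $ j $ q)"
  obtains l where "B = l *\<^sub>R mat 1"
proof -
  have comm: "B ** Ad_mat G \<xi> k = Ad_mat G \<xi> k ** B" if k: "k \<in> K" for k
  proof -
    let ?Q = "Ad_mat G \<xi> k"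
    have "B = ?Q ** B ** transpose ?Q"
      unfolding vec_eq_iff
    proof (intro allI)
      fix i j
      have "B $ i $ j = (\<Sum>q\<in>UNIV. \<Sum>p\<in>UNIV. B $ p $ q * ?Q $ i $ p * ?Q $ j $ q)"
        using inv[OF k] by (subst sum.swap) blast
      also have "\<dots> = (?Q ** B ** transpose ?Q) $ i $ j"
        by (simp add: matrix_matrix_mult_def transpose_def sum_distrib_left sum_distrib_right mult_ac)
      finally show "B $ i $ j = (?Q ** B ** transpose ?Q) $ i $ j" .
    qed
    then have "B ** ?Q = ?Q ** B ** (transpose ?Q ** ?Q)"
      by (metis matrix_mul_assoc)
    also have "transpose ?Q ** ?Q = mat 1"
      using orthogonal_Ad_mat[OF basis orth k linear_Ad_K[OF k] Ad_invariant_p[OF k]]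
      by (simp add: orthogonal_matrix)
    finally show ?thesis by simp
  qed
  obtain l u where u: "u \<noteq> 0" "B *v u = l *\<^sub>R u"
    using symmetric_matrix_has_eigenvector[OF sym] .
  let ?L = "\<lambda>v :: real ^ 'n. lin_comb \<xi> (($) v)"
  \<comment> \<open>The eigenspace carried over to \<open>\<pp>\<close>; injectivity of the
    transport later brings the conclusion \<open>W = \<pp>\<close> back to the matrix.\<close>
  define W where "W = ?L ` {v. B *v v = l *\<^sub>R v}"
  have "subspace {v. B *v v = l *\<^sub>R v}"
    by (auto simp: subspace_def matrix_vector_right_distrib matrix_vector_mult_scaleR scaleR_add_right)
  then have "subspace W"
    unfolding W_def by (rule linear_subspace_image[OF linear_lin_comb])
  moreover have "W \<subseteq> \<pp>"
    using lin_comb_in[OF basis] by (auto simp: W_def)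
  moreover have "Ad G k ` W \<subseteq> W" if k: "k \<in> K" for k
  proof -
    have "B *v (Ad_mat G \<xi> k *v v) = l *\<^sub>R (Ad_mat G \<xi> k *v v)" if "B *v v = l *\<^sub>R v" for v
    proof -
      have "B *v (Ad_mat G \<xi> k *v v) = Ad_mat G \<xi> k *v (B *v v)"
        by (simp add: matrix_vector_mul_assoc comm[OF k])
      then show ?thesis by (simp add: that matrix_vector_mult_scaleR)
    qed
    then show ?thesis
      by (auto simp: W_def Ad_lin_comb[OF basis linear_Ad_K[OF k] Ad_invariant_p[OF k]])
  qed
  ultimately have "W = {0} \<or> W = \<pp>"
    using irred by (simp add: Ad_irreducible_def)
  moreover have "?L u \<in> W" "?L u \<noteq> 0"
    using u injD[OF inj_lin_comb[OF basis], of u 0] linear_0[OF linear_lin_comb, of \<xi>]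
    by (auto simp: W_def)
  ultimately have "W = \<pp>" by auto
  have "B *v v = (l *\<^sub>R mat 1) *v v" for v
  proof -
    have "?L v \<in> W" using lin_comb_in[OF basis] \<open>W = \<pp>\<close> by simp
    then have "B *v v = l *\<^sub>R v"
      using injD[OF inj_lin_comb[OF basis]] by (auto simp: W_def)
    then show ?thesis by (simp flip: scaleR_matrix_vector_assoc)
  qed
  then have "B = l *\<^sub>R mat 1" by (simp add: matrix_eq)
  then show thesis by (rule that)
qed

lemma covariance_function_eq_scalar:
  fixes \<xi> :: "'n::finite \<Rightarrow> 'v"
  assumes irred: "Ad_irreducible G K \<pp>" and basis: "indexed_basis \<xi> \<pp>"
    and orth: "Ad_orthonormal G K \<pp> \<xi>" and A: "covariance_function G K \<xi> A"
  shows "\<exists>a. mono_on {0..} a \<and> continuous_on {0..} a \<and> a 0 = 0 \<and>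
    (\<forall>t\<ge>0. A t = a t *\<^sub>R (mat 1 :: real ^ 'n ^ 'n))"
proof -
  \<comment> \<open>Any diagonal entry can serve as the scalar function, and an index exists because
    types are nonempty.\<close>
  fix i :: 'n
  define a where "a t = A t $ i $ i" for t
  have "A t = a t *\<^sub>R mat 1" if "0 \<le> t" for t
  proof -
    have sym: "transpose (A t) = A t"
      and inv: "\<And>k i j. k \<in> K \<Longrightarrow> A t $ i $ j =
        (\<Sum>p\<in>UNIV. \<Sum>q\<in>UNIV. A t $ p $ q * Ad_mat G \<xi> k $ i $ p * Ad_mat G \<xi> k $ j $ q)"
      using A that unfolding covariance_function_def by blast+
    obtain l where "A t = l *\<^sub>R mat 1"
      using Ad_invariant_matrix_eq_scalar[OF irred basis orth sym inv] .
    then show ?thesis by (simp add: a_def mat_def)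
  qed
  moreover have "mono_on {0..} a"
  proof (rule mono_onI)
    fix s t :: real
    assume st: "s \<in> {0..}" "t \<in> {0..}" "s \<le> t"
    \<comment> \<open>Testing nonnegative definiteness of the increment on a unit coordinate vector
      isolates its diagonal entry.\<close>
    have "0 \<le> axis i 1 \<bullet> ((A t - A s) *v axis i 1)" if "s < t"
      using A that st by (simp add: covariance_function_def)
    then show "a s \<le> a t"
      using st by (cases "s = t") (simp_all add: a_def inner_axis' matrix_vector_mult_basis column_def)
  qed
  moreover have "continuous_on {0..} a" "a 0 = 0"
    using A by (auto simp: covariance_function_def a_def)
  ultimately show ?thesis by blast
qed

end

section \<open>Borel measures and time slices\<close>

lemma space_borel_of_top [simp]: "space (borel_of_top T) = topspace T"
  unfolding borel_of_top_def by (rule space_measure_of) (auto dest: openin_subset)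

lemma sets_borel_of_top: "sets (borel_of_top T) = sigma_sets (topspace T) (Collect (openin T))"
  unfolding borel_of_top_def by (rule sets_measure_of) (auto dest: openin_subset)

lemma measurable_borel_of_top:
  assumes "continuous_map T T' f"
  shows "f \<in> borel_of_top T \<rightarrow>\<^sub>M borel_of_top T'"
proof (rule measurable_sigma_sets[OF sets_borel_of_top])
  show "Collect (openin T') \<subseteq> Pow (topspace T')"
    by (auto dest: openin_subset)
  show "f \<in> space (borel_of_top T) \<rightarrow> topspace T'"
    using assms by (auto simp: continuous_map_def)
  show "f -` U \<inter> space (borel_of_top T) \<in> sets (borel_of_top T)" if "U \<in> Collect (openin T')" for U
  proof -
    have "f -` U \<inter> space (borel_of_top T) = {x \<in> topspace T. f x \<in> U}" by auto
    also have "openin T \<dots>" using assms that by (simp add: continuous_map_def)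
    finally show ?thesis unfolding sets_borel_of_top by (intro sigma_sets.Basic) simp
  qed
qed

lemma borel_measurable_borel_of_top:
  fixes f :: "'a \<Rightarrow> 'b::topological_space"
  assumes "continuous_map T euclidean f"
  shows "f \<in> borel_measurable (borel_of_top T)"
proof (rule borel_measurableI)
  fix U :: "'b set"
  assume "open U"
  have "f -` U \<inter> space (borel_of_top T) = {x \<in> topspace T. f x \<in> U}" by auto
  also have "openin T \<dots>" using assms \<open>open U\<close> by (simp add: continuous_map_def)
  finally show "f -` U \<inter> space (borel_of_top T) \<in> sets (borel_of_top T)"
    unfolding sets_borel_of_top by (intro sigma_sets.Basic) simp
qed

text \<open>
  Where \<open>\<eta> t\<close> is finite, the slice of \<open>N\<close> at \<open>t\<close> is the limit of
  \<open>\<eta> t - \<eta> s\<close> as \<open>s\<close> increases to \<open>t\<close>; \<open>\<sigma>\<close>-finiteness of \<open>\<eta> t\<close> reduces to this case.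
\<close>

lemma space_time_slice_vimage:
  assumes \<eta>: "measure_function E \<eta>" and N: "space_time_measure E \<eta> N"
    and T: "T \<in> E \<rightarrow>\<^sub>M E"
    and inv: "\<And>s B. 0 \<le> s \<Longrightarrow> B \<in> sets E \<Longrightarrow> emeasure (\<eta> s) (T -` B \<inter> space E) = emeasure (\<eta> s) B"
    and t: "0 < t" and B: "B \<in> sets E"
  shows "emeasure N ({t} \<times> (T -` B \<inter> space E)) = emeasure N ({t} \<times> B)"
proof -
  have sets_N: "sets N = sets (restrict_space borel {0..} \<Otimes>\<^sub>M E)"
    and N_eq: "\<And>s B. 0 \<le> s \<Longrightarrow> B \<in> sets E \<Longrightarrow> emeasure N ({0..s} \<times> B) = emeasure (\<eta> s) B"
    using N by (auto simp: space_time_measure_def)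
  have rect: "I \<times> C \<in> sets N" if "I \<in> sets borel" "I \<subseteq> {0..}" "C \<in> sets E" for I C
    using that unfolding sets_N by (intro pair_measureI) (auto simp: sets_restrict_space_iff)
  have sets_\<eta>: "sets (\<eta> t) = sets E" "sigma_finite_measure (\<eta> t)"
    using \<eta> t by (auto simp: measure_function_def)
  \<comment> \<open>This sequence starts at 0 and increases to \<open>t\<close> while staying
    strictly below it, so the half-open intervals from \<open>s n\<close> to \<open>t\<close> shrink
    exactly to the point \<open>t\<close>.\<close>
  define s where "s n = t - t / real (Suc n)" for n
  have s: "0 \<le> s n" "s n < t" for n
    using t by (auto simp: s_def field_simps)
  have s_mono: "s m \<le> s n" if "m \<le> n" for m n
    using t that by (auto simp: s_def intro!: divide_left_mono)
  have s_lim: "s \<longlonglongrightarrow> t"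
    using tendsto_diff[OF tendsto_const LIMSEQ_Suc[OF lim_const_over_n[of t]], of t]
    by (simp add: s_def[abs_def])
  \<comment> \<open>Continuity from above along these shrinking strips; the finiteness assumption
    both permits it and turns the mass of a strip into a difference.\<close>
  have slice: "(\<lambda>n. emeasure (\<eta> t) C - emeasure (\<eta> (s n)) C) \<longlonglongrightarrow> emeasure N ({t} \<times> C)"
    if C: "C \<in> sets E" and fin: "emeasure (\<eta> t) C \<noteq> \<infinity>" for C
  proof -
    have sub: "{0..s n} \<times> C \<subseteq> {0..t} \<times> C" for n using s[of n] by auto
    have le: "emeasure N A \<noteq> \<infinity>" if "A \<subseteq> {0..t} \<times> C" for A
      using fin N_eq[of t C] t C emeasure_mono[OF that, of N] rect[of "{0..t}" C]
      by (auto simp: top_unique)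
    have diff: "{s n<..t} \<times> C = {0..t} \<times> C - {0..s n} \<times> C" for n
      using s[of n] by auto
    have "emeasure N ({s n<..t} \<times> C) = emeasure (\<eta> t) C - emeasure (\<eta> (s n)) C" for n
      unfolding diff
      using emeasure_Diff[OF le[OF sub] rect rect sub, of n] C s[of n] t by (simp add: N_eq)
    moreover have "(\<lambda>n. emeasure N ({s n<..t} \<times> C)) \<longlonglongrightarrow> emeasure N (\<Inter>n. {s n<..t} \<times> C)"
    proof (rule Lim_emeasure_decseq)
      show "range (\<lambda>n. {s n<..t} \<times> C) \<subseteq> sets N"
      proof clarify
        show "{s n<..t} \<times> C \<in> sets N" for n using C s(1)[of n] by (intro rect) auto
      qed
      show "decseq (\<lambda>n. {s n<..t} \<times> C)"
      proof (rule antimonoI)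
        show "{s n<..t} \<times> C \<subseteq> {s m<..t} \<times> C" if "m \<le> n" for m n
          using s_mono[OF that] by auto
      qed
      show "emeasure N ({s n<..t} \<times> C) \<noteq> \<infinity>" for n
        by (rule le) (use diff in auto)
    qed
    moreover have "(\<Inter>n. {s n<..t} \<times> C) = {t} \<times> C"
    proof -
      have "r = t" if "\<And>n. s n < r" "r \<le> t" for r
        using LIMSEQ_le_const2[OF s_lim, of r] less_imp_le[OF that(1)] that(2) by fastforce
      then have "(\<Inter>n. {s n<..t}) = {t}" using s(2) by auto
      then show ?thesis by auto
    qed
    ultimately show ?thesis by simp
  qed
  let ?T = "\<lambda>C. T -` C \<inter> space E"
  have T_sets: "?T C \<in> sets E" if "C \<in> sets E" for C using measurable_sets[OF T that] .
  \<comment> \<open>\<open>T\<close> preserves \<open>\<eta> r\<close> at every time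
    \<open>r\<close>, so a set and its preimage have the same sequence of differences and hence the
    same limit.\<close>
  have fin: "emeasure N ({t} \<times> ?T C) = emeasure N ({t} \<times> C)"
    if C: "C \<in> sets E" and f: "emeasure (\<eta> t) C \<noteq> \<infinity>" for C
  proof -
    have "emeasure (\<eta> r) (?T C) = emeasure (\<eta> r) C" if "0 \<le> r" for r
      using inv[OF that C] .
    then have "(\<lambda>n. emeasure (\<eta> t) C - emeasure (\<eta> (s n)) C) \<longlonglongrightarrow> emeasure N ({t} \<times> ?T C)"
      using slice[OF T_sets[OF C]] f t s by simp
    then show ?thesis using slice[OF C f] by (rule LIMSEQ_unique)
  qed
  interpret \<eta>t: sigma_finite_measure "\<eta> t" by (rule sets_\<eta>(2))
  obtain A :: "nat \<Rightarrow> _" where A: "range A \<subseteq> sets (\<eta> t)" "(\<Union>i. A i) = space (\<eta> t)"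
      "\<And>i. emeasure (\<eta> t) (A i) \<noteq> \<infinity>" "disjoint_family A"
    by (rule \<eta>t.sigma_finite_disjoint) blast
  have A_sets: "A i \<in> sets E" for i using A(1) sets_\<eta>(1) by auto
  have A_un: "(\<Union>i. A i) = space E" using A(2) sets_eq_imp_space_eq[OF sets_\<eta>(1)] by simp
  have split: "emeasure N ({t} \<times> D) = (\<Sum>i. emeasure N ({t} \<times> D' i))"
    if "D = (\<Union>i. D' i)" "\<And>i. D' i \<in> sets E" "disjoint_family D'" for D D'
  proof -
    have "range (\<lambda>i. {t} \<times> D' i) \<subseteq> sets N" using rect that t by auto
    moreover have "disjoint_family (\<lambda>i. {t} \<times> D' i)"
      using that(3) by (auto simp: disjoint_family_on_def)
    moreover have "{t} \<times> D = (\<Union>i. {t} \<times> D' i)" using that(1) by auto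
    ultimately show ?thesis by (simp only: suminf_emeasure)
  qed
  have "emeasure N ({t} \<times> ?T B) = (\<Sum>i. emeasure N ({t} \<times> ?T (B \<inter> A i)))"
  proof (rule split)
    show "?T B = (\<Union>i. ?T (B \<inter> A i))"
      using A_un measurable_space[OF T] by blast
    show "disjoint_family (\<lambda>i. ?T (B \<inter> A i))"
      using A(4) by (fastforce simp: disjoint_family_on_def)
  qed (intro T_sets sets.Int B A_sets)
  also have "\<dots> = (\<Sum>i. emeasure N ({t} \<times> (B \<inter> A i)))"
  proof (rule suminf_cong, rule fin)
    show "emeasure (\<eta> t) (B \<inter> A i) \<noteq> \<infinity>" for i
      using A(3)[of i] emeasure_mono[of "B \<inter> A i" "A i" "\<eta> t"] A(1) by (auto simp: top_unique)
  qed (use B A_sets in auto)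
  also have "\<dots> = emeasure N ({t} \<times> B)"
  proof (rule split[symmetric])
    show "B = (\<Union>i. B \<inter> A i)" using A_un sets.sets_into_space[OF B] by blast
    show "disjoint_family (\<lambda>i. B \<inter> A i)"
      using A(4) by (fastforce simp: disjoint_family_on_def)
  qed (use B A_sets in auto)
  finally show ?thesis .
qed

section \<open>Invariance in the homogeneous space\<close>

context homogeneous_space
begin

section \<open>Cosets and the quotient topology\<close>

lemma lcosets_eq: "lcosets K = proj G K ` carrier G"
  by (auto simp: LCOSETS_def proj_def)

lemma act_proj: "g \<in> carrier G \<Longrightarrow> h \<in> carrier G \<Longrightarrow> act G g (proj G K h) = proj G K (g \<otimes> h)"
  using lcos_m_assoc[OF K_subset] by (simp add: act_def proj_def)

lemma proj_K: "k \<in> K \<Longrightarrow> proj G K k = K"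
  using coset_join3 K_subset subgroup_K by (auto simp: proj_def)

lemma proj_eq_K_iff: "g \<in> carrier G \<Longrightarrow> proj G K g = K \<longleftrightarrow> g \<in> K"
  using lcos_self[OF _ subgroup_K] proj_K by (fastforce simp: proj_def)

lemma one_in_K: "\<one> \<in> K"
  using subgroup_K by (rule subgroup.one_closed)

lemma K_in_lcosets: "K \<in> lcosets K"
  unfolding lcosets_eq using proj_K[OF one_in_K] by (metis imageI one_closed)

lemma act_in_lcosets: "g \<in> carrier G \<Longrightarrow> x \<in> lcosets K \<Longrightarrow> act G g x \<in> lcosets K"
  by (auto simp: lcosets_eq act_proj)

lemma act_inv_cancel:
  assumes "g \<in> carrier G" "x \<in> lcosets K"
  shows "act G g (act G (inv g) x) = x"
  using assms by (auto simp: lcosets_eq act_proj m_assoc[symmetric])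

lemma act_K: "g \<in> carrier G \<Longrightarrow> act G g K = proj G K g"
  using act_proj[OF _ one_closed] proj_K[OF one_in_K] by simp

text \<open>Elements of \<open>K\<close> fix the base point and act injectively. This will make the
  point mass at the base point in \<open>jump_law\<close> invariant.\<close>

lemma act_eq_K_iff:
  assumes k: "k \<in> K" and x: "x \<in> lcosets K"
  shows "act G k x = K \<longleftrightarrow> x = K"
proof
  have kG: "k \<in> carrier G" "inv k \<in> K"
    using k K_subset subgroup.m_inv_closed[OF subgroup_K] by auto
  show "x = K" if "act G k x = K"
    using act_inv_cancel[of "inv k" x] kG x that K_subset act_K[of "inv k"] proj_K
    by (metis inv_closed inv_inv)
  show "act G k x = K" if "x = K"
    using that act_K kG proj_K k by simp
qed

lemma openin_lcosets: "openin (quot_top G K) (lcosets K)"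
proof -
  have "{g \<in> carrier G. proj G K g \<in> lcosets K} = topspace (topol G)"
    by (auto simp: lcosets_eq topspace_topol)
  then show ?thesis by (simp add: openin_quot_top)
qed

lemma topspace_quot_top [simp]: "topspace (quot_top G K) = lcosets K"
  by (meson openin_lcosets openin_quot_top openin_subset openin_topspace subset_antisym)

text \<open>The preimage of the base point under the projection is \<open>K\<close>, which is closed
  in the group. Hence a path that is eventually at the base point has no other limit.\<close>

lemma closedin_base_point: "closedin (quot_top G K) {K}"
proof -
  have "{g \<in> carrier G. proj G K g \<in> lcosets K - {K}} = topspace (topol G) - K"
    using proj_eq_K_iff by (auto simp: lcosets_eq topspace_topol)
  moreover have "openin (topol G) (topspace (topol G) - K)"
    using closed_K by blast
  ultimately show ?thesis
    using K_in_lcosets by (simp add: closedin_def openin_quot_top)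
qed

lemma continuous_map_act:
  assumes g: "g \<in> carrier G"
  shows "continuous_map (quot_top G K) (quot_top G K) (act G g)"
  unfolding continuous_map_def
proof (intro conjI allI impI)
  show "act G g \<in> topspace (quot_top G K) \<rightarrow> topspace (quot_top G K)"
    using act_in_lcosets[OF g] by auto
  fix W assume "openin (quot_top G K) W"
  then have "openin (topol G) {h \<in> carrier G. proj G K h \<in> W}"
    by (simp add: openin_quot_top)
  then have "openin (topol G) {h \<in> topspace (topol G). g \<otimes> h \<in> {h \<in> carrier G. proj G K h \<in> W}}"
    using continuous_map_left_mult[OF g] by (blast intro: openin_continuous_map_preimage)
  moreover have "{h \<in> topspace (topol G). g \<otimes> h \<in> {h \<in> carrier G. proj G K h \<in> W}} =
      {h \<in> carrier G. proj G K h \<in> {x \<in> lcosets K. act G g x \<in> W}}"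
    using g by (auto simp: topspace_topol lcosets_eq act_proj)
  ultimately show "openin (quot_top G K) {x \<in> topspace (quot_top G K). act G g x \<in> W}"
    by (simp add: openin_quot_top)
qed

text \<open>Smoothness is tested on charts of the group. The resulting local continuity is glued
  over the atlas to continuity of \<open>f\<close> composed with the projection, which descends by
  the definition of the quotient topology.\<close>

lemma continuous_map_smooth_quot:
  assumes f: "smooth_quot_on G K (lcosets K) f"
  shows "continuous_map (quot_top G K) euclideanreal f"
proof -
  have "continuous_map (topol G) euclideanreal (\<lambda>g. f (proj G K g))"
  proof (rule pasting_lemma[where I = "atlas G" and T = fst and f = "\<lambda>c g. f (proj G K g)"])
    fix c assume c: "c \<in> atlas G"
    show "openin (topol G) (fst c)" using chart_domain[OF c] by simp
    let ?D = "snd c ` fst c"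
    let ?F = "\<lambda>u. f (proj G K (chart_inv c u))"
    have "{g \<in> fst c. proj G K g \<in> lcosets K} = fst c"
      using chart_subset[OF c] by (auto simp: lcosets_eq)
    then have "continuous_on ?D ?F"
      using f c smooth_on_imp_continuous_on by (fastforce simp: smooth_quot_on_def)
    then have "continuous_map (top_of_set ?D) euclideanreal ?F" by simp
    from continuous_map_compose[OF homeomorphic_imp_continuous_map[OF chart_homeomorphic[OF c]] this]
    show "continuous_map (subtopology (topol G) (fst c)) euclideanreal (\<lambda>g. f (proj G K g))"
      by (rule continuous_map_eq) (simp add: chart_inv_left[OF c])
  next
    show "\<exists>c. c \<in> atlas G \<and> g \<in> fst c \<and> f (proj G K g) = f (proj G K g)"
      if "g \<in> topspace (topol G)" for g
      using that charts_cover topspace_topol by (metis UN_E)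
  qed simp
  then have "openin (topol G) {g \<in> carrier G. f (proj G K g) \<in> U}" if "open U" for U
    using that by (simp add: continuous_map_def topspace_topol)
  moreover have "{g \<in> carrier G. proj G K g \<in> {x \<in> lcosets K. f x \<in> U}} =
      {g \<in> carrier G. f (proj G K g) \<in> U}" for U
    by (auto simp: lcosets_eq)
  ultimately show ?thesis
    by (simp add: continuous_map_def openin_quot_top)
qed

lemma continuous_map_Cc_smooth: "f \<in> Cc_smooth G K \<Longrightarrow> continuous_map (quot_top G K) euclideanreal f"
  by (simp add: Cc_smooth_def continuous_map_smooth_quot)

lemma Cc_smooth_bounded:
  assumes f: "f \<in> Cc_smooth G K"
  obtains C where "\<And>x. x \<in> lcosets K \<Longrightarrow> \<bar>f x\<bar> \<le> C"
proof -
  let ?S = "quot_top G K closure_of {x \<in> lcosets K. f x \<noteq> 0}"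
  have "compactin (quot_top G K) ?S" using f by (simp add: Cc_smooth_def)
  then have "compact (f ` ?S)"
    using image_compactin[OF _ continuous_map_Cc_smooth[OF f]] by simp
  then obtain C where C: "\<And>x. x \<in> ?S \<Longrightarrow> \<bar>f x\<bar> \<le> C"
    using compact_imp_bounded[of "f ` ?S"] by (auto simp: bounded_iff)
  have "{x \<in> lcosets K. f x \<noteq> 0} \<subseteq> ?S"
    by (rule closure_of_subset) auto
  \<comment> \<open>The maximum with 0 covers the points where \<open>f\<close> vanishes, which may
    lie outside the support.\<close>
  then have "\<bar>f x\<bar> \<le> max C 0" if "x \<in> lcosets K" for x
    using C[of x] that by (cases "f x = 0") auto
  then show thesis by (rule that)
qed

text \<open>By the homomorphism law \<open>lexp G 0\<close> is idempotent, and the identity is the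
  only idempotent of a group.\<close>

lemma lexp_zero: "lexp G 0 = \<one>"
proof -
  have "lexp G 0 \<in> carrier G"
    using lexp_continuous[of 0] by (simp add: continuous_map_def topspace_topol)
  moreover have "lexp G 0 \<otimes> lexp G 0 = lexp G 0"
    using lexp_hom[of 0 0 0] by simp
  ultimately show ?thesis by (metis l_cancel_one)
qed

lemma exp_coord_eq_base_point: "lin_comb \<xi> c = 0 \<Longrightarrow> exp_coord G K \<xi> c = K"
  by (simp add: exp_coord_def lexp_zero proj_K one_in_K)

section \<open>Fixed vectors and invariant points\<close>

lemma Ad_fixed_eq_zero:
  fixes \<xi> :: "'n::finite \<Rightarrow> 'v"
  assumes irred: "Ad_irreducible G K \<pp>" and basis: "indexed_basis \<xi> \<pp>"
    and dim1: "CARD('n) = 1 \<longrightarrow> (\<exists>k\<in>K. \<exists>v\<in>\<pp>. Ad G k v \<noteq> v)"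
    and v: "v \<in> \<pp>" "\<And>k. k \<in> K \<Longrightarrow> Ad G k v = v"
  shows "v = 0"
proof -
  define W where "W = {v \<in> \<pp>. \<forall>k\<in>K. Ad G k v = v}"
  have "subspace W"
    using subspace_p linear_Ad_K unfolding W_def subspace_def
    by (auto simp: linear_0 linear_add linear_scale)
  moreover have "W \<subseteq> \<pp>" "\<forall>k\<in>K. Ad G k ` W \<subseteq> W" by (auto simp: W_def)
  ultimately have "W = {0} \<or> W = \<pp>" using irred unfolding Ad_irreducible_def by blast
  moreover have "W \<noteq> \<pp>"
  proof
    \<comment> \<open>Under a trivial action every line is invariant, so irreducibility would force
      dimension one, where \<open>dim1\<close> rules out the trivial action.\<close>
    assume "W = \<pp>"
    then have triv: "Ad G k u = u" if "k \<in> K" "u \<in> \<pp>" for k u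
      using that by (auto simp: W_def)
    have b: "inj \<xi>" "independent (range \<xi>)" "span (range \<xi>) = \<pp>"
      using basis by (auto simp: indexed_basis_def)
    have "CARD('n) \<noteq> 1" using dim1 triv by blast
    then obtain i j :: 'n where "j \<noteq> i"
      by (metis UNIV_I UNIV_eq_I card_1_singleton_iff One_nat_def singletonI singleton_iff)
    let ?L = "span {\<xi> i}"
    have "subspace ?L" by simp
    moreover have "?L \<subseteq> \<pp>" using b(3) by (metis empty_subsetI insert_subset rangeI span_mono)
    moreover from this have "\<forall>k\<in>K. Ad G k ` ?L \<subseteq> ?L" using triv by auto
    ultimately have "?L = {0} \<or> ?L = \<pp>" using irred unfolding Ad_irreducible_def by blast
    moreover have "\<xi> i \<in> ?L" "\<xi> i \<noteq> 0"
      using b(2) dependent_zero[of "range \<xi>"] by (auto intro: span_base)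
    ultimately have "\<xi> j \<in> ?L" using b(3) span_base[of "\<xi> j" "range \<xi>"] by auto
    moreover have "{\<xi> i} \<subseteq> range \<xi> - {\<xi> j}" using b(1) \<open>j \<noteq> i\<close> by (auto dest: injD)
    ultimately have "\<xi> j \<in> span (range \<xi> - {\<xi> j})" using span_mono by blast
    then show False using b(2) by (auto simp: dependent_def)
  qed
  ultimately show ?thesis using v by (auto simp: W_def)
qed

text \<open>At an invariant point, equivariance of the coordinate functions says that the coordinate
  vector is fixed by the adjoint action.\<close>

lemma coordinates_K_invariant_point:
  fixes \<xi> :: "'n::finite \<Rightarrow> 'v"
  assumes irred: "Ad_irreducible G K \<pp>" and basis: "indexed_basis \<xi> \<pp>"
    and dim1: "CARD('n) = 1 \<longrightarrow> (\<exists>k\<in>K. \<exists>v\<in>\<pp>. Ad G k v \<noteq> v)"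
    and \<phi>: "coordinate_functions G K \<xi> \<phi>" and x: "K_invariant_point G K x"
  shows "lin_comb \<xi> (\<lambda>i. \<phi> i x) = 0"
proof (rule Ad_fixed_eq_zero[OF irred basis dim1 lin_comb_in[OF basis]])
  fix k assume k: "k \<in> K"
  have "Ad G k (lin_comb \<xi> (\<lambda>i. \<phi> i x)) = (\<Sum>i\<in>UNIV. \<phi> i x *\<^sub>R Ad G k (\<xi> i))"
    using linear_Ad_K[OF k] by (simp add: lin_comb_def linear_sum linear_scale)
  also have "\<dots> = (\<Sum>i\<in>UNIV. \<phi> i (act G k x) *\<^sub>R \<xi> i)"
    using \<phi> k x by (simp add: coordinate_functions_def K_invariant_point_def)
  also have "\<dots> = lin_comb \<xi> (\<lambda>i. \<phi> i x)"
    using k x by (simp add: K_invariant_point_def lin_comb_def)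
  finally show "Ad G k (lin_comb \<xi> (\<lambda>i. \<phi> i x)) = lin_comb \<xi> (\<lambda>i. \<phi> i x)" .
qed

text \<open>Near the base point a point is recovered from its coordinates through
  \<open>exp_coord\<close>, and an invariant point has zero coordinate vector.\<close>

lemma base_point_isolated:
  fixes \<xi> :: "'n::finite \<Rightarrow> 'v"
  assumes irred: "Ad_irreducible G K \<pp>" and basis: "indexed_basis \<xi> \<pp>"
    and dim1: "CARD('n) = 1 \<longrightarrow> (\<exists>k\<in>K. \<exists>v\<in>\<pp>. Ad G k v \<noteq> v)"
    and \<phi>: "coordinate_functions G K \<xi> \<phi>"
  obtains W where "openin (quot_top G K) W" "K \<in> W"
    "\<And>x. x \<in> W \<Longrightarrow> K_invariant_point G K x \<Longrightarrow> x = K"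
proof -
  obtain W where W: "openin (quot_top G K) W" "K \<in> W" "\<forall>x\<in>W. x = exp_coord G K \<xi> (\<lambda>i. \<phi> i x)"
    using \<phi> unfolding coordinate_functions_def by blast
  have "x = K" if "x \<in> W" "K_invariant_point G K x" for x
    using W(3) that(1) exp_coord_eq_base_point[OF coordinates_K_invariant_point[OF assms that(2)]]
    by auto
  then show thesis using that W by blast
qed

section \<open>The jump laws and their means\<close>

lemma space_jump_law [simp]: "space (jump_law G K N t) = lcosets K"
  and sets_jump_law: "sets (jump_law G K N t) = sets (quot_borel G K)"
proof -
  have "sets (quot_borel G K) \<subseteq> Pow (lcosets K)"
    using sets.space_closed[of "quot_borel G K"] by simp
  moreover have "sigma_sets (lcosets K) (sets (quot_borel G K)) = sets (quot_borel G K)"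
    using sets.sigma_sets_eq[of "quot_borel G K"] by simp
  ultimately show "space (jump_law G K N t) = lcosets K"
    "sets (jump_law G K N t) = sets (quot_borel G K)"
    by (simp_all add: jump_law_def space_measure_of sets_measure_of)
qed

text \<open>\<open>measure_of\<close> has the prescribed values only once they are known to be
  countably additive. In \<open>indicator B K\<close> the coset \<open>K\<close> is the base point,
  so the second term is its point mass.\<close>

lemma emeasure_jump_law:
  assumes N: "space_time_measure (quot_borel G K) \<eta> N" and t: "0 \<le> t"
    and B: "B \<in> sets (quot_borel G K)"
  shows "emeasure (jump_law G K N t) B =
    emeasure N ({t} \<times> B) + (1 - emeasure N ({t} \<times> lcosets K)) * indicator B K"
proof (rule emeasure_measure_of[OF jump_law_def])
  show "sets (quot_borel G K) \<subseteq> Pow (lcosets K)"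
    using sets.space_closed[of "quot_borel G K"] by simp
  show "B \<in> sets (jump_law G K N t)" using B by (simp add: sets_jump_law)
  let ?c = "1 - emeasure N ({t} \<times> lcosets K)"
  let ?f = "\<lambda>B. emeasure N ({t} \<times> B) + ?c * indicator B K"
  show "positive (sets (jump_law G K N t)) ?f" by (simp add: positive_def)
  show "countably_additive (sets (jump_law G K N t)) ?f"
  proof (rule countably_additiveI)
    fix A :: "nat \<Rightarrow> _"
    assume A: "range A \<subseteq> sets (jump_law G K N t)" "disjoint_family A"
    have "{t} \<times> A i \<in> sets N" for i
      using N A(1) t by (auto simp: space_time_measure_def sets_restrict_space_iff sets_jump_law
          intro!: pair_measureI)
    then have "(\<Sum>i. emeasure N ({t} \<times> A i)) = emeasure N (\<Union>i. {t} \<times> A i)"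
      using A(2) by (intro suminf_emeasure) (auto simp: disjoint_family_on_def)
    also have "(\<Union>i. {t} \<times> A i) = {t} \<times> (\<Union>i. A i)" by auto
    finally show "(\<Sum>i. ?f (A i)) = ?f (\<Union>i. A i)"
      using suminf_indicator[OF A(2), of K]
      by (simp add: suminf_add[symmetric] ennreal_suminf_cmult)
  qed
qed

lemma act_measurable:
  "g \<in> carrier G \<Longrightarrow> act G g \<in> quot_borel G K \<rightarrow>\<^sub>M quot_borel G K"
  by (intro measurable_borel_of_top continuous_map_act)

text \<open>Invariance of all \<open>\<eta> s\<close> passes to the slice of \<open>N\<close> at
  \<open>t\<close> by \<open>space_time_slice_vimage\<close>, and the remaining mass sits at a fixed
  point.\<close>

lemma jump_law_K_invariant:
  assumes \<eta>: "extended_levy_measure G K \<xi> \<phi> \<eta> N" and t: "0 < t"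
  shows "K_invariant_measure G K (jump_law G K N t)"
  unfolding K_invariant_measure_def
proof
  fix k assume k: "k \<in> K"
  have mf: "measure_function (quot_borel G K) \<eta>" and N: "space_time_measure (quot_borel G K) \<eta> N"
    and inv: "\<And>s. 0 \<le> s \<Longrightarrow> distr (\<eta> s) (quot_borel G K) (act G k) = \<eta> s"
    using \<eta> k by (auto simp: extended_levy_measure_def K_invariant_measure_def)
  have act: "act G k \<in> quot_borel G K \<rightarrow>\<^sub>M quot_borel G K"
    using k K_subset by (intro act_measurable) auto
  have inv': "emeasure (\<eta> s) (act G k -` B \<inter> lcosets K) = emeasure (\<eta> s) B"
    if s: "0 \<le> s" and B: "B \<in> sets (quot_borel G K)" for s B
  proof -
    have se: "sets (\<eta> s) = sets (quot_borel G K)" using mf s by (simp add: measure_function_def)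
    then have "act G k \<in> \<eta> s \<rightarrow>\<^sub>M quot_borel G K" using act measurable_cong_sets by blast
    from emeasure_distr[OF this B] show ?thesis
      using inv[OF s] sets_eq_imp_space_eq[OF se] by simp
  qed
  let ?\<nu> = "jump_law G K N t"
  show "distr ?\<nu> (quot_borel G K) (act G k) = ?\<nu>"
  proof (rule measure_eqI)
    show "sets (distr ?\<nu> (quot_borel G K) (act G k)) = sets ?\<nu>" by (simp add: sets_jump_law)
    fix B assume "B \<in> sets (distr ?\<nu> (quot_borel G K) (act G k))"
    then have B: "B \<in> sets (quot_borel G K)" by simp
    have act': "act G k \<in> ?\<nu> \<rightarrow>\<^sub>M quot_borel G K"
      using act measurable_cong_sets[OF sets_jump_law refl] by blast
    have C: "act G k -` B \<inter> lcosets K \<in> sets (quot_borel G K)"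
      using measurable_sets[OF act B] by simp
    have "emeasure (distr ?\<nu> (quot_borel G K) (act G k)) B =
        emeasure ?\<nu> (act G k -` B \<inter> lcosets K)"
      using emeasure_distr[OF act' B] by simp
    also have "\<dots> = emeasure ?\<nu> B"
    proof -
      have "emeasure N ({t} \<times> (act G k -` B \<inter> space (quot_borel G K))) = emeasure N ({t} \<times> B)"
        using inv' by (intro space_time_slice_vimage[OF mf N act _ t B]) simp
      moreover have "indicator (act G k -` B \<inter> lcosets K) K = (indicator B K :: ennreal)"
        using act_eq_K_iff[OF k K_in_lcosets] K_in_lcosets by (simp add: indicator_def)
      ultimately show ?thesis
        using t by (simp add: emeasure_jump_law[OF N _ C] emeasure_jump_law[OF N _ B])
    qed
    finally show "emeasure (distr ?\<nu> (quot_borel G K) (act G k)) B = emeasure ?\<nu> B" .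
  qed
qed

lemma jump_mean_eq_base_point:
  fixes \<xi> :: "'n::finite \<Rightarrow> 'v"
  assumes irred: "Ad_irreducible G K \<pp>" and basis: "indexed_basis \<xi> \<pp>"
    and dim1: "CARD('n) = 1 \<longrightarrow> (\<exists>k\<in>K. \<exists>v\<in>\<pp>. Ad G k v \<noteq> v)"
    and \<phi>: "coordinate_functions G K \<xi> \<phi>"
    and \<eta>: "extended_levy_measure G K \<xi> \<phi> \<eta> N" and t: "0 < t"
  shows "jump_mean G K \<xi> \<phi> N t = K"
proof -
  let ?\<nu> = "jump_law G K N t"
  have N: "space_time_measure (quot_borel G K) \<eta> N" and mass: "emeasure N ({t} \<times> lcosets K) \<le> 1"
    using \<eta> t by (auto simp: extended_levy_measure_def)
  have "emeasure ?\<nu> (space ?\<nu>) = emeasure N ({t} \<times> lcosets K) + (1 - emeasure N ({t} \<times> lcosets K))"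
    using emeasure_jump_law[OF N, of t "lcosets K"] t K_in_lcosets
      sets.top[of "quot_borel G K"] by simp
  \<comment> \<open>Subtraction in \<open>ennreal\<close> is truncated; the bound on the slice mass
    makes the two terms add up to 1.\<close>
  then have "emeasure ?\<nu> (space ?\<nu>) = 1"
    using mass by (simp add: diff_add_self_ennreal add.commute)
  then interpret \<nu>: finite_measure ?\<nu> by (intro finite_measureI) simp
  have \<phi>_smooth: "\<phi> i \<in> Cc_smooth G K" for i
    using \<phi> by (simp add: coordinate_functions_def)
  have meas: "\<phi> i \<in> borel_measurable (quot_borel G K)" for i
    using continuous_map_Cc_smooth[OF \<phi>_smooth] by (rule borel_measurable_borel_of_top)
  have int: "integrable ?\<nu> (\<phi> i)" for i
  proof -
    obtain C where "\<And>x. x \<in> lcosets K \<Longrightarrow> \<bar>\<phi> i x\<bar> \<le> C"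
      using Cc_smooth_bounded[OF \<phi>_smooth[of i]] by blast
    moreover have "\<phi> i \<in> borel_measurable ?\<nu>"
      using meas measurable_cong_sets[OF sets_jump_law refl] by blast
    ultimately show ?thesis
      by (intro \<nu>.integrable_const_bound[where B = C]) auto
  qed
  \<comment> \<open>The mean vector is shown to be fixed: \<open>Ad G k\<close> moves inside the
    integral, equivariance turns it into a translation of the argument, and invariance of the jump
    law absorbs that translation.\<close>
  define c where "c i = (LINT x|?\<nu>. \<phi> i x)" for i
  have "lin_comb \<xi> c = 0"
  proof (rule Ad_fixed_eq_zero[OF irred basis dim1 lin_comb_in[OF basis]])
    fix k assume k: "k \<in> K"
    have act: "act G k \<in> ?\<nu> \<rightarrow>\<^sub>M quot_borel G K"
      using act_measurable k K_subset measurable_cong_sets[OF sets_jump_law refl] by blast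
    have distr: "distr ?\<nu> (quot_borel G K) (act G k) = ?\<nu>"
      using jump_law_K_invariant[OF \<eta> t] k by (simp add: K_invariant_measure_def)
    have c_act: "c i = (LINT x|?\<nu>. \<phi> i (act G k x))" for i
      using integral_distr[OF act meas] distr by (simp add: c_def)
    have int_act: "integrable ?\<nu> (\<lambda>x. \<phi> i (act G k x))" for i
      using integrable_distr_eq[OF act meas] distr int by simp
    have "Ad G k (lin_comb \<xi> c) = (\<Sum>i\<in>UNIV. c i *\<^sub>R Ad G k (\<xi> i))"
      using linear_Ad_K[OF k] by (simp add: lin_comb_def linear_sum linear_scale)
    also have "\<dots> = (LINT x|?\<nu>. (\<Sum>i\<in>UNIV. \<phi> i x *\<^sub>R Ad G k (\<xi> i)))"
      using int by (simp add: c_def)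
    also have "\<dots> = (LINT x|?\<nu>. (\<Sum>i\<in>UNIV. \<phi> i (act G k x) *\<^sub>R \<xi> i))"
      using \<phi> k by (intro Bochner_Integration.integral_cong) (auto simp: coordinate_functions_def)
    also have "\<dots> = lin_comb \<xi> c"
      using int_act by (simp add: c_act lin_comb_def)
    finally show "Ad G k (lin_comb \<xi> c) = lin_comb \<xi> c" .
  qed
  then show ?thesis
    by (simp add: jump_mean_def c_def[abs_def] exp_coord_eq_base_point)
qed

section \<open>Triviality of the drift\<close>

lemma limitin_eventually_base_point:
  assumes "limitin (quot_top G K) c l F" "eventually (\<lambda>t. c t = K) F" "F \<noteq> bot"
  shows "l = K"
proof -
  have "eventually (\<lambda>t. c t \<in> {K}) F" using assms(2) by simp
  from limitin_closedin[OF assms(1) closedin_base_point this assms(3)] show ?thesis by simp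
qed

lemma extended_drift_trivial:
  fixes \<xi> :: "'n::finite \<Rightarrow> 'v"
  assumes irred: "Ad_irreducible G K \<pp>" and basis: "indexed_basis \<xi> \<pp>"
    and dim1: "CARD('n) = 1 \<longrightarrow> (\<exists>k\<in>K. \<exists>v\<in>\<pp>. Ad G k v \<noteq> v)"
    and \<phi>: "coordinate_functions G K \<xi> \<phi>" and S: "borel_section G K S"
    and triple: "extended_levy_triple G K \<xi> S \<phi> b A \<eta> N" and t: "0 \<le> t"
  shows "b t = K"
proof (rule ccontr)
  assume neq: "b t \<noteq> K"
  have rcll: "rcll (quot_top G K) b" and b0: "b 0 = K"
    and fixed: "\<And>s. 0 \<le> s \<Longrightarrow> K_invariant_point G K (b s)"
    and \<eta>: "extended_levy_measure G K \<xi> \<phi> \<eta> N"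
    and jump: "\<And>s. 0 < s \<Longrightarrow> xldiv G S (left_lim (quot_top G K) b s) (b s) = jump_mean G K \<xi> \<phi> N s"
    using triple by (auto simp: extended_levy_triple_def extended_drift_def)
  \<comment> \<open>All jumps \<open>h\<^sub>s\<close> vanish, so \<open>b\<close> is continuous.\<close>
  have left: "limitin (quot_top G K) b (b s) (at_left s)" if s: "0 < s" for s
  proof -
    define l where "l = left_lim (quot_top G K) b s"
    have lim: "limitin (quot_top G K) b l (at_left s)"
      using rcll s unfolding l_def left_lim_def rcll_def by (metis someI_ex)
    then have l: "l \<in> lcosets K" by (auto simp: limitin_def)
    have Sl: "S l \<in> carrier G" "proj G K (S l) = l"
      using S l by (auto simp: borel_section_def)
    have "act G (inv (S l)) (b s) = K"
      using jump[OF s] jump_mean_eq_base_point[OF irred basis dim1 \<phi> \<eta> s]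
      by (simp add: xldiv_def l_def)
    \<comment> \<open>Applying \<open>S l\<close> to both sides undoes the left division; since
      \<open>S\<close> is a section, the right side is then the left limit \<open>l\<close>.\<close>
    then have "b s = act G (S l) K"
      using act_inv_cancel[OF Sl(1)] fixed[of s] s by (metis K_invariant_point_def less_imp_le)
    then have "b s = l" using act_K Sl by simp
    then show ?thesis using lim by simp
  qed
  \<comment> \<open>\<open>T\<close> is the infimum of the times spent away from the base point. It
    will be shown that \<open>b\<close> is at the base point up to and including \<open>T\<close>
    and for some time afterwards, which contradicts the infimum.\<close>
  define Z where "Z = {s. 0 \<le> s \<and> b s \<noteq> K}"
  define T where "T = Inf Z"
  have Z: "t \<in> Z" "bdd_below Z" using t neq by (auto simp: Z_def bdd_below_def)
  have T0: "0 \<le> T" unfolding T_def using Z(1) by (intro cInf_greatest) (auto simp: Z_def)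
  have before: "b s = K" if "0 \<le> s" "s < T" for s
    using that cInf_lower[OF _ Z(2), of s] by (fastforce simp: T_def Z_def)
  have bT: "b T = K"
  proof (cases "T = 0")
    case False
    then have "0 < T" using T0 by simp
    then have "eventually (\<lambda>s. b s = K) (at_left T)"
      unfolding eventually_at_left_field using before by (intro exI[of _ 0]) auto
    then show ?thesis
      using limitin_eventually_base_point left[OF \<open>0 < T\<close>] by fastforce
  qed (use b0 in simp)
  obtain W where W: "openin (quot_top G K) W" "K \<in> W"
    "\<And>x. x \<in> W \<Longrightarrow> K_invariant_point G K x \<Longrightarrow> x = K"
    using base_point_isolated[OF irred basis dim1 \<phi>] by blast
  \<comment> \<open>Right continuity brings \<open>b\<close> into \<open>W\<close> just after
    \<open>T\<close>, and there its only possible value is the base point since \<open>b\<close>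
    takes invariant values.\<close>
  have "limitin (quot_top G K) b K (at_right T)"
    using rcll T0 bT unfolding rcll_def by metis
  then have "eventually (\<lambda>s. b s \<in> W) (at_right T)"
    using W by (simp add: limitin_def)
  then obtain d where d: "T < d" "\<And>s. T < s \<Longrightarrow> s < d \<Longrightarrow> b s \<in> W"
    unfolding eventually_at_right_field by blast
  have "d \<le> s" if "s \<in> Z" for s
  proof (rule ccontr)
    assume "\<not> d \<le> s"
    moreover have "T \<le> s" unfolding T_def using that Z(2) by (rule cInf_lower)
    moreover have "s \<noteq> T" using that bT by (auto simp: Z_def)
    ultimately have "b s \<in> W" using d(2) by simp
    then show False using W(3) fixed[of s] that by (auto simp: Z_def)
  qed
  then have "d \<le> T" unfolding T_def using Z(1) by (intro cInf_greatest) auto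
  then show False using d(1) by simp
qed

end

text \<open>\<open>Ad_orthonormal\<close> selects bases for which the invariant symmetric matrices
  are multiples of the identity rather than of another positive definite matrix. The clause on
  \<open>CARD('n) = 1\<close> excludes cases like the real line with trivial \<open>K\<close>, which
  is irreducible but has nontrivial drifts.\<close>

theorem proposition31:
  fixes G :: "('g, 'v::euclidean_space) lie_data" and K :: "'g set" and \<pp> :: "'v set"
    and \<xi> :: "'n::finite \<Rightarrow> 'v"
    and V :: "'v set" and \<phi> :: "'n \<Rightarrow> 'g set \<Rightarrow> real" and S :: "'g set \<Rightarrow> 'g"
    and M :: "'w measure" and x :: "real \<Rightarrow> 'w \<Rightarrow> 'g set"
    and b :: "real \<Rightarrow> 'g set" and A' :: "real \<Rightarrow> real ^ 'n ^ 'n"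
    and \<eta> :: "real \<Rightarrow> 'g set measure" and N :: "(real \<times> 'g set) measure"
  assumes "homogeneous_space G K \<pp>"
    and "compactin (topol G) K"
    and "Ad_irreducible G K \<pp>"
    and "indexed_basis \<xi> \<pp>"
  shows "(Ad_orthonormal G K \<pp> \<xi> \<longrightarrow>
      (\<forall>A. covariance_function G K \<xi> A \<longrightarrow>
        (\<exists>a. mono_on {0..} a \<and> continuous_on {0..} a \<and> a 0 = 0 \<and>
             (\<forall>t\<ge>0. A t = a t *\<^sub>R (mat 1 :: real ^ 'n ^ 'n)))))
    \<and>
     ((CARD('n) = 1 \<longrightarrow> (\<exists>k\<in>K. \<exists>v\<in>\<pp>. Ad G k v \<noteq> v)) \<and>
      exp_diffeo_nbhd G K \<pp> \<xi> V \<and>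
      coordinate_functions G K \<xi> \<phi> \<and>
      (\<forall>y\<in>lcosets\<^bsub>G\<^esub> K. (\<Sum>i\<in>UNIV. \<phi> i y *\<^sub>R \<xi> i) \<in> V) \<and>
      borel_section G K S \<and>
      inhomogeneous_levy G K M x \<and> (AE \<omega> in M. x 0 \<omega> = K) \<and>
      extended_levy_triple G K \<xi> S \<phi> b A' \<eta> N \<and>
      represents G K \<xi> S \<phi> b A' N M x
      \<longrightarrow> (\<forall>t\<ge>0. b t = K))"
proof -
  interpret homogeneous_space G K \<pp> by (rule assms(1))
  show ?thesis
    using covariance_function_eq_scalar[OF assms(3,4)] extended_drift_trivial[OF assms(3,4)]
    by blast
qed

end
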